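(* Let $(W,S)$ be a Coxeter system and $\lambda$ a labelling of a staircase diagram $\mathcal D$ on its Coxeter–Dynkin graph. Then: (a) $\Lambda(\operatorname{flip}(\mathcal D),\lambda^{-1})=\Lambda(\mathcal D,\lambda)^{-1}$, where $\lambda^{-1}(B)=\lambda(B)^{-1}$; (b) $D_R(\Lambda(\mathcal D))=\{s\in S: \min(\mathcal D_s)\preceq\min(\mathcal D_t)\text{ for all }t\sim s,\text{ and }s\in D_R(\lambda(\min\mathcal D_s))\}$; (c) $D_L(\Lambda(\mathcal D))=\{s\in S: \max(\mathcal D_s)\succeq\max(\mathcal D_t)\text{ for all }t\sim s,\text{ and }s\in D_L(\lambda(\max\mathcal D_s))\}$.
   Context: Coxeter system $(W,S)$; Coxeter–Dynkin graph on $S$ with $s\sim t$ iff $m_{st}\ge3$. For $J\subseteq S$: $W_J$ parabolic subgroup; $u_J$ its longest element when finite ($J$ spherical). $D_L,D_R$ descent sets, $S(w)$ support of $w$. Staircase diagram: a poset $(\mathcal D,\preceq)$ of nonempty subsets (blocks) of $S$ with: (1) each block connected in the graph, and if $B$ covers $B'$ then $B\cup B'$ connected; (2) $\mathcal D_s=\{B: s\in B\}$ is a chain for all $s$; (3) if $s\sim t$, $\mathcal D_s\cup\mathcal D_t$ is a chain in which $\mathcal D_s,\mathcal D_t$ are saturated; (4) each $B$ is the minimum of some $\mathcal D_s$ and the maximum of some $\mathcal D_{s'}$. $\operatorname{flip}(\mathcal D)$ is the same set with the reverse partial order (again a staircase diagram). $J_R(B)=\{s\in B: B\neq\min\mathcal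 D_s\}$, $J_L(B)=\{s\in B: B\neq\max\mathcal D_s\}$. If all these are spherical, a labelling is $\lambda:\mathcal D\to W$ with $J_R(B)\subseteq D_R(\lambda(B))$, $J_L(B)\subseteq D_L(\lambda(B))$, $S(\lambda(B)u_{J_R(B)})=S(u_{J_L(B)}\lambda(B))=B$ ($\lambda^{-1}$ is then a labelling of $\operatorname{flip}(\mathcal D)$). $\overline\lambda(B)=\lambda(B)u_{J_R(B)}$ and $\Lambda(\mathcal D,\lambda)=\overline\lambda(B_n)\cdots\overline\lambda(B_1)$ for any linear extension $B_1,\dots,B_n$ of $\mathcal D$. *)

theory Defs
  imports "HOL-Algebra.Algebra"
begin

section \<open>Coxeter systems\<close>

definition word_prod :: "('a, 'm) monoid_scheme \<Rightarrow> 'a list \<Rightarrow> 'a" where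
  "word_prod W ws = foldr (\<lambda>x y. x \<otimes>\<^bsub>W\<^esub> y) ws \<one>\<^bsub>W\<^esub>"

text \<open>
  The order of \<open>s t\<close>. As \<open>group.ord\<close> is \<open>0\<close> on elements of infinite order,
  the value \<open>0\<close> encodes \<open>m\<^sub>s\<^sub>t = \<infinity>\<close>.
\<close>

definition coxeter_m :: "('a, 'm) monoid_scheme \<Rightarrow> 'a \<Rightarrow> 'a \<Rightarrow> nat" where
  "coxeter_m W s t = group.ord W (s \<otimes>\<^bsub>W\<^esub> t)"

text \<open>
  Deletion of a relator \<open>(s t)\<^sup>m\<close> inside a word over \<open>S\<close>. For \<open>m\<^sub>s\<^sub>t = \<infinity>\<close> the relator
  below is the empty word, so no relation is imposed.
\<close>

inductive relator_step :: "('a, 'm) monoid_scheme \<Rightarrow> 'a set \<Rightarrow> 'a list \<Rightarrow> 'a list \<Rightarrow> bool"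
  for W :: "('a, 'm) monoid_scheme" and S :: "'a set" where
  "\<lbrakk>s \<in> S; t \<in> S; u \<in> lists S; v \<in> lists S\<rbrakk> \<Longrightarrow>
     relator_step W S (u @ concat (replicate (coxeter_m W s t) [s, t]) @ v) (u @ v)"

text \<open>
  \<open>W\<close> is generated by the set \<open>S\<close> of involutions and presented by the relations
  \<open>(s t)\<^sup>m = 1\<close>, where \<open>m = m\<^sub>s\<^sub>t\<close> is finite. The relations \<open>s s = 1\<close> (the case \<open>s = t\<close>,
  \<open>m = 1\<close>) make formal inverses of the generators superfluous, so the presentation is
  expressed with words over \<open>S\<close> itself: words with equal product are connected by insertions
  and deletions of relators. (The converse implication holds in every group.)
\<close>

definition coxeter_system :: "('a, 'm) monoid_scheme \<Rightarrow> 'a set \<Rightarrow> bool" where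
  "coxeter_system W S \<longleftrightarrow>
     group W \<and> S \<subseteq> carrier W \<and> generate W S = carrier W \<and>
     (\<forall>s\<in>S. group.ord W s = 2) \<and>
     (\<forall>u\<in>lists S. \<forall>v\<in>lists S.
        word_prod W u = word_prod W v \<longrightarrow> equivclp (relator_step W S) u v)"

text \<open>\<open>m\<^sub>s\<^sub>t \<ge> 3\<close>, including \<open>m\<^sub>s\<^sub>t = \<infinity>\<close>.\<close>

definition coxeter_adj :: "('a, 'm) monoid_scheme \<Rightarrow> 'a \<Rightarrow> 'a \<Rightarrow> bool" where
  "coxeter_adj W s t \<longleftrightarrow> coxeter_m W s t = 0 \<or> coxeter_m W s t \<ge> 3"

definition cox_length :: "('a, 'm) monoid_scheme \<Rightarrow> 'a set \<Rightarrow> 'a \<Rightarrow> nat" where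
  "cox_length W S w = (LEAST n. \<exists>ws\<in>lists S. length ws = n \<and> word_prod W ws = w)"

definition right_descents :: "('a, 'm) monoid_scheme \<Rightarrow> 'a set \<Rightarrow> 'a \<Rightarrow> 'a set" where
  "right_descents W S w = {s \<in> S. cox_length W S (w \<otimes>\<^bsub>W\<^esub> s) < cox_length W S w}"

definition left_descents :: "('a, 'm) monoid_scheme \<Rightarrow> 'a set \<Rightarrow> 'a \<Rightarrow> 'a set" where
  "left_descents W S w = {s \<in> S. cox_length W S (s \<otimes>\<^bsub>W\<^esub> w) < cox_length W S w}"

text \<open>
  The generators occurring in reduced words for \<open>w\<close> (all reduced words for \<open>w\<close> use the same
  generators).
\<close>

definition support :: "('a, 'm) monoid_scheme \<Rightarrow> 'a set \<Rightarrow> 'a \<Rightarrow> 'a set" where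
  "support W S w =
     {s. \<exists>ws\<in>lists S. word_prod W ws = w \<and> length ws = cox_length W S w \<and> s \<in> set ws}"

definition spherical :: "('a, 'm) monoid_scheme \<Rightarrow> 'a set \<Rightarrow> bool" where
  "spherical W J \<longleftrightarrow> finite (generate W J)"

text \<open>Only meaningful for spherical \<open>J\<close>.\<close>

definition longest_element :: "('a, 'm) monoid_scheme \<Rightarrow> 'a set \<Rightarrow> 'a set \<Rightarrow> 'a" where
  "longest_element W S J =
     (THE u. u \<in> generate W J \<and> (\<forall>w\<in>generate W J. cox_length W S w \<le> cox_length W S u))"


section \<open>Staircase diagrams\<close>

text \<open>
  A poset of blocks is a carrier \<open>D\<close> with a relation \<open>R\<close> such that \<open>partial_order_on D R\<close>, where
  \<open>(B, B') \<in> R\<close> means \<open>B \<preceq> B'\<close>. In particular the flip of \<open>(D, R)\<close> is \<open>(D, R\<inverse>)\<close>.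
\<close>

text \<open>Connectedness of the subgraph induced on \<open>B\<close>.\<close>

definition graph_connected :: "('a \<Rightarrow> 'a \<Rightarrow> bool) \<Rightarrow> 'a set \<Rightarrow> bool" where
  "graph_connected adj B \<longleftrightarrow> (\<forall>s\<in>B. \<forall>t\<in>B. (s, t) \<in> {(x, y). x \<in> B \<and> y \<in> B \<and> adj x y}\<^sup>*)"

definition covers :: "'b rel \<Rightarrow> 'b \<Rightarrow> 'b \<Rightarrow> bool" where
  "covers R B B' \<longleftrightarrow> (B', B) \<in> R \<and> B' \<noteq> B \<and>
     (\<forall>C. (B', C) \<in> R \<and> (C, B) \<in> R \<longrightarrow> C = B' \<or> C = B)"

definition is_minimum :: "'b rel \<Rightarrow> 'b set \<Rightarrow> 'b \<Rightarrow> bool" where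
  "is_minimum R C B \<longleftrightarrow> B \<in> C \<and> (\<forall>B'\<in>C. (B, B') \<in> R)"

definition is_maximum :: "'b rel \<Rightarrow> 'b set \<Rightarrow> 'b \<Rightarrow> bool" where
  "is_maximum R C B \<longleftrightarrow> B \<in> C \<and> (\<forall>B'\<in>C. (B', B) \<in> R)"

definition minimum :: "'b rel \<Rightarrow> 'b set \<Rightarrow> 'b" where
  "minimum R C = (THE B. is_minimum R C B)"

definition maximum :: "'b rel \<Rightarrow> 'b set \<Rightarrow> 'b" where
  "maximum R C = (THE B. is_maximum R C B)"

text \<open>\<open>C\<close> is a saturated subchain of the chain \<open>C'\<close>: no element of \<open>C'\<close> can be inserted
  between two elements of \<open>C\<close>.\<close>

definition saturated_in :: "'b rel \<Rightarrow> 'b set \<Rightarrow> 'b set \<Rightarrow> bool" where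
  "saturated_in R C C' \<longleftrightarrow> C \<subseteq> C' \<and>
     (\<forall>A\<in>C. \<forall>B\<in>C. \<forall>Z\<in>C'. (A, Z) \<in> R \<and> (Z, B) \<in> R \<longrightarrow> Z \<in> C)"

definition blocks_at :: "'a set set \<Rightarrow> 'a \<Rightarrow> 'a set set" where
  "blocks_at D s = {B \<in> D. s \<in> B}"

definition staircase_diagram ::
  "'a set \<Rightarrow> ('a \<Rightarrow> 'a \<Rightarrow> bool) \<Rightarrow> 'a set set \<Rightarrow> 'a set rel \<Rightarrow> bool" where
  "staircase_diagram S adj D R \<longleftrightarrow>
     partial_order_on D R \<and>
     (\<forall>B\<in>D. B \<noteq> {} \<and> B \<subseteq> S) \<and>
     (\<forall>B\<in>D. graph_connected adj B) \<and>
     (\<forall>B\<in>D. \<forall>B'\<in>D. covers R B B' \<longrightarrow> graph_connected adj (B \<union> B')) \<and>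
     (\<forall>s\<in>S. blocks_at D s \<in> Chains R) \<and>
     (\<forall>s\<in>S. \<forall>t\<in>S. adj s t \<longrightarrow>
        blocks_at D s \<union> blocks_at D t \<in> Chains R \<and>
        saturated_in R (blocks_at D s) (blocks_at D s \<union> blocks_at D t) \<and>
        saturated_in R (blocks_at D t) (blocks_at D s \<union> blocks_at D t)) \<and>
     (\<forall>B\<in>D. (\<exists>s\<in>S. is_minimum R (blocks_at D s) B) \<and>
             (\<exists>s\<in>S. is_maximum R (blocks_at D s) B))"

definition J_R :: "'a set set \<Rightarrow> 'a set rel \<Rightarrow> 'a set \<Rightarrow> 'a set" where
  "J_R D R B = {s \<in> B. B \<noteq> minimum R (blocks_at D s)}"

definition J_L :: "'a set set \<Rightarrow> 'a set rel \<Rightarrow> 'a set \<Rightarrow> 'a set" where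
  "J_L D R B = {s \<in> B. B \<noteq> maximum R (blocks_at D s)}"

definition labelling ::
  "('a, 'm) monoid_scheme \<Rightarrow> 'a set \<Rightarrow> 'a set set \<Rightarrow> 'a set rel \<Rightarrow> ('a set \<Rightarrow> 'a) \<Rightarrow> bool" where
  "labelling W S D R lab \<longleftrightarrow>
     (\<forall>B\<in>D. spherical W (J_R D R B) \<and> spherical W (J_L D R B)) \<and>
     (\<forall>B\<in>D. lab B \<in> carrier W \<and>
        J_R D R B \<subseteq> right_descents W S (lab B) \<and>
        J_L D R B \<subseteq> left_descents W S (lab B) \<and>
        support W S (lab B \<otimes>\<^bsub>W\<^esub> longest_element W S (J_R D R B)) = B \<and>
        support W S (longest_element W S (J_L D R B) \<otimes>\<^bsub>W\<^esub> lab B) = B)"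

definition lambda_bar ::
  "('a, 'm) monoid_scheme \<Rightarrow> 'a set \<Rightarrow> 'a set set \<Rightarrow> 'a set rel \<Rightarrow> ('a set \<Rightarrow> 'a) \<Rightarrow> 'a set \<Rightarrow> 'a" where
  "lambda_bar W S D R lab B = lab B \<otimes>\<^bsub>W\<^esub> longest_element W S (J_R D R B)"

definition linear_extension :: "'b set \<Rightarrow> 'b rel \<Rightarrow> 'b list \<Rightarrow> bool" where
  "linear_extension D R Bs \<longleftrightarrow> distinct Bs \<and> set Bs = D \<and>
     (\<forall>i<length Bs. \<forall>j<length Bs. (Bs ! i, Bs ! j) \<in> R \<longrightarrow> i \<le> j)"

text \<open>
  For a linear extension \<open>B\<^sub>1, \<dots>, B\<^sub>n\<close> the factor of \<open>B\<^sub>n\<close> comes first. The definite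
  description determines a value only because all linear extensions of a finite labelled
  staircase diagram give the same product.
\<close>

definition Lambda ::
  "('a, 'm) monoid_scheme \<Rightarrow> 'a set \<Rightarrow> 'a set set \<Rightarrow> 'a set rel \<Rightarrow> ('a set \<Rightarrow> 'a) \<Rightarrow> 'a" where
  "Lambda W S D R lab =
     (THE w. \<exists>Bs. linear_extension D R Bs \<and>
                  w = word_prod W (map (lambda_bar W S D R lab) (rev Bs)))"

end

theory Submission
  imports Defs
begin

text \<open>
  List the blocks as a linear extension in decreasing order \<open>C # L\<close>, with \<open>X = \<Union>L\<close>, and write
  \<open>u\<^sub>J\<close> for the longest element of \<open>W\<^sub>J\<close>. Then \<open>J\<^sub>R(C) = C \<inter> X\<close>, so the factor
  \<open>\<lambda>(C) u\<^sub>J\<close> with \<open>J = C \<inter> X\<close> has no right descent in \<open>X\<close> and lengths add up in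
  \<open>\<Lambda>(C # L) = \<lambda>(C) u\<^sub>J \<Lambda>(L)\<close>.

  If \<open>A\<close> is a union of blocks above \<open>L\<close>, saturation says that generators in \<open>A \<inter> X\<close> outside a block
  of \<open>L\<close> lying between their occurrences commute with that block. Pushing \<open>u\<^bsub>A \<inter> X\<^esub>\<close>
  through \<open>\<Lambda>(L)\<close> therefore turns it into the product of the factors
  \<open>u\<^bsub>B \<inter> A'\<^esub> \<lambda>(B)\<close>, where \<open>A'\<close> is the union of \<open>A\<close> and the blocks of \<open>L\<close> before \<open>B\<close>.
  For empty \<open>A\<close> this is (a).

  For \<open>A = C\<close> it gives \<open>\<Lambda>(C # L) = \<lambda>(C) m\<close>, where \<open>m\<close> has support \<open>X\<close> and no left descent in
  \<open>C\<close>. A right descent \<open>s \<in> C - X\<close> of this product must, by the exchange condition, satisfy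
  \<open>m s = r m\<close> with \<open>r \<in> C\<close>; hence \<open>r = s\<close>, \<open>s\<close> commutes with all of \<open>X\<close>, and \<open>s\<close> is a right
  descent of \<open>\<lambda>(C)\<close>. This is (b), and (c) follows by flipping the diagram.
\<close>

section \<open>Coxeter groups\<close>

lemma equivclp_invariant:
  assumes "equivclp r x y" and "\<And>a b. r a b \<Longrightarrow> f a = f b"
  shows "f x = f y"
  using assms(1) by (induction rule: equivclp_induct) (auto dest: assms(2))

locale coxeter_group = group W for W :: "('a, 'm) monoid_scheme" (structure) +
  fixes S :: "'a set"
  assumes S_carrier: "S \<subseteq> carrier W"
    and generate_S: "generate W S = carrier W"
    and ord_S: "s \<in> S \<Longrightarrow> ord s = 2"
    and presentation: "\<lbrakk>u \<in> lists S; v \<in> lists S; word_prod W u = word_prod W v\<rbrakk>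
          \<Longrightarrow> equivclp (relator_step W S) u v"

lemma coxeter_system_imp_coxeter_group:
  "coxeter_system W S \<Longrightarrow> coxeter_group W S"
  unfolding coxeter_system_def coxeter_group_def coxeter_group_axioms_def by auto

context coxeter_group
begin

abbreviation pr :: "'a list \<Rightarrow> 'a" where "pr \<equiv> word_prod W"
abbreviation len :: "'a \<Rightarrow> nat" where "len \<equiv> cox_length W S"
abbreviation par :: "'a set \<Rightarrow> 'a set" where "par \<equiv> generate W"

section \<open>Words over the generators and the subgroups they generate\<close>

lemma S_closed [simp]: "s \<in> S \<Longrightarrow> s \<in> carrier W"
  using S_carrier by auto

lemma S_square [simp]: "s \<in> S \<Longrightarrow> s \<otimes> s = \<one>"
  using pow_ord_eq_1[of s] ord_S[of s] by (simp add: numeral_2_eq_2)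

lemma S_inv [simp]: "s \<in> S \<Longrightarrow> inv s = s"
  by (simp add: inv_equality)

lemma S_cancel [simp]: "\<lbrakk>s \<in> S; x \<in> carrier W\<rbrakk> \<Longrightarrow> s \<otimes> (s \<otimes> x) = x"
  by (simp flip: m_assoc)

lemma S_cancel_right [simp]: "\<lbrakk>s \<in> S; x \<in> carrier W\<rbrakk> \<Longrightarrow> x \<otimes> s \<otimes> s = x"
  by (simp add: m_assoc)

lemma S_ne_one: "s \<in> S \<Longrightarrow> s \<noteq> \<one>"
  using ord_S[of s] ord_eq_1[of s] by auto

lemma pr_Nil [simp]: "pr [] = \<one>" and pr_Cons [simp]: "pr (s # u) = s \<otimes> pr u"
  by (auto simp: word_prod_def)

lemma pr_closed [simp]: "set u \<subseteq> carrier W \<Longrightarrow> pr u \<in> carrier W"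
  by (induction u) auto

lemma lists_S_carrier [simp]: "u \<in> lists S \<Longrightarrow> set u \<subseteq> carrier W"
  using S_carrier by auto

lemma pr_append: "\<lbrakk>set u \<subseteq> carrier W; set v \<subseteq> carrier W\<rbrakk> \<Longrightarrow> pr (u @ v) = pr u \<otimes> pr v"
  by (induction u) (auto simp: m_assoc)

lemma pr_append_S: "\<lbrakk>u \<in> lists S; v \<in> lists S\<rbrakk> \<Longrightarrow> pr (u @ v) = pr u \<otimes> pr v"
  by (simp add: pr_append)

lemma pr_rev: "u \<in> lists S \<Longrightarrow> pr (rev u) = inv (pr u)"
  by (induction u) (auto simp: pr_append inv_mult_group)

text \<open>The generators are involutions, so the inverse of a letter is that letter and plain
  words over \<open>J\<close> already exhaust the subgroup.\<close>

lemma pr_eq_generate: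
  assumes "J \<subseteq> S"
  shows "generate W J = pr ` lists J"
proof
  have "w \<in> pr ` lists J" if "w \<in> generate W J" for w
    using that
  proof induction
    case one
    then show ?case by (intro image_eqI[of _ _ "[]"]) auto
  next
    case (incl h)
    then show ?case using assms by (intro image_eqI[of _ _ "[h]"]) auto
  next
    case (inv h)
    then show ?case using assms by (intro image_eqI[of _ _ "[h]"]) auto
  next
    case (eng h1 h2)
    then obtain u v where "u \<in> lists J" "v \<in> lists J" "h1 = pr u" "h2 = pr v" by auto
    moreover from this have "set u \<subseteq> carrier W" "set v \<subseteq> carrier W" using assms by auto
    ultimately show ?case by (intro image_eqI[of _ _ "u @ v"]) (auto simp: pr_append)
  qed
  then show "generate W J \<subseteq> pr ` lists J" by auto
  have "pr u \<in> generate W J" if "u \<in> lists J" for u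
    using that by (induction u) (auto intro: generate.intros)
  then show "pr ` lists J \<subseteq> generate W J" by auto
qed

lemma par_carrier: "J \<subseteq> S \<Longrightarrow> w \<in> par J \<Longrightarrow> w \<in> carrier W"
  using generate_in_carrier S_carrier by (meson subset_trans)

lemma par_mult: "\<lbrakk>x \<in> par J; y \<in> par J\<rbrakk> \<Longrightarrow> x \<otimes> y \<in> par J"
  by (rule generate.eng)

lemma par_inv: "\<lbrakk>J \<subseteq> S; x \<in> par J\<rbrakk> \<Longrightarrow> inv x \<in> par J"
  using generate_m_inv_closed S_carrier by (meson subset_trans)

lemma par_mono: "J \<subseteq> K \<Longrightarrow> x \<in> par J \<Longrightarrow> x \<in> par K"
  using mono_generate by blast

lemma par_gen: "s \<in> J \<Longrightarrow> s \<in> par J"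
  by (rule generate.incl)

lemma pr_in_par: "J \<subseteq> S \<Longrightarrow> u \<in> lists J \<Longrightarrow> pr u \<in> par J"
  by (simp add: pr_eq_generate)

subsection \<open>Length\<close>

lemma ex_word: "w \<in> carrier W \<Longrightarrow> \<exists>u\<in>lists S. pr u = w"
  using pr_eq_generate[of S] generate_S by auto

lemma ex_reduced: "w \<in> carrier W \<Longrightarrow> \<exists>u\<in>lists S. length u = len w \<and> pr u = w"
  unfolding cox_length_def by (rule LeastI_ex) (use ex_word in blast)

lemma len_le: "u \<in> lists S \<Longrightarrow> len (pr u) \<le> length u"
  unfolding cox_length_def by (rule Least_le) auto

lemma len_one [simp]: "len \<one> = 0"
  using len_le[of "[]"] by simp

lemma len_0D: "\<lbrakk>w \<in> carrier W; len w = 0\<rbrakk> \<Longrightarrow> w = \<one>"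
  using ex_reduced[of w] by auto

lemma len_mult:
  assumes "x \<in> carrier W" "y \<in> carrier W"
  shows "len (x \<otimes> y) \<le> len x + len y"
proof -
  obtain u v where "u \<in> lists S" "length u = len x" "pr u = x"
      "v \<in> lists S" "length v = len y" "pr v = y"
    using ex_reduced assms by meson
  then show ?thesis using len_le[of "u @ v"] by (simp add: pr_append)
qed

lemma len_S [simp]: "s \<in> S \<Longrightarrow> len s = 1"
  using len_le[of "[s]"] len_0D[of s] S_ne_one by (cases "len s") auto

lemma len_inv [simp]:
  assumes "x \<in> carrier W"
  shows "len (inv x) = len x"
proof -
  have "len (inv y) \<le> len y" if "y \<in> carrier W" for y
  proof -
    obtain u where "u \<in> lists S" "length u = len y" "pr u = y" using ex_reduced \<open>y \<in> carrier W\<close> by meson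
    moreover from this have "rev u \<in> lists S" by auto
    ultimately show ?thesis using len_le[of "rev u"] pr_rev[of u] by simp
  qed
  from this[of x] this[of "inv x"] assms show ?thesis by simp
qed

definition reduced :: "'a list \<Rightarrow> bool" where
  "reduced u \<longleftrightarrow> u \<in> lists S \<and> length u = len (pr u)"

subsection \<open>The reflection cocycle and the exchange condition\<close>

text \<open>For the word s_1 ... s_k, entry i is the reflection s_1 ... s_(i-1) s_i s_(i-1) ... s_1.
  A list keeps multiplicities, and their parity is the cocycle that descends to the group.\<close>

fun refls :: "'a list \<Rightarrow> 'a list" where
  "refls [] = []" |
  "refls (s # u) = s # map (\<lambda>t. s \<otimes> t \<otimes> s) (refls u)"

lemma refls_carrier: "u \<in> lists S \<Longrightarrow> set (refls u) \<subseteq> carrier W"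
  by (induction u) auto

lemma conj_S_inj:
  assumes "s \<in> S" "x \<in> carrier W" "y \<in> carrier W" "s \<otimes> x \<otimes> s = s \<otimes> y \<otimes> s"
  shows "x = y"
  using assms by (metis S_closed m_assoc l_cancel r_cancel m_closed)

lemma count_refls_conj:
  assumes "s \<in> S" "set xs \<subseteq> carrier W" "r \<in> carrier W"
  shows "count_list (map (\<lambda>t. s \<otimes> t \<otimes> s) xs) r = count_list xs (s \<otimes> r \<otimes> s)"
proof -
  have "s \<otimes> t \<otimes> s = r \<longleftrightarrow> t = s \<otimes> r \<otimes> s" if "t \<in> carrier W" for t
  proof -
    have "s \<otimes> (s \<otimes> z \<otimes> s) \<otimes> s = z" if "z \<in> carrier W" for z
      using assms(1) that by (simp add: m_assoc)
    from this[OF that] this[OF assms(3)] show ?thesis by auto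
  qed
  with assms(2) show ?thesis by (induction xs) auto
qed

text \<open>Recursion of the cocycle: conjugation by \<open>s\<close> is an involution, so counting
  \<open>r\<close> in the conjugated list means counting \<open>s \<otimes> r \<otimes> s\<close> in
  the original one.\<close>

lemma count_refls_Cons:
  assumes "s \<in> S" "u \<in> lists S" "r \<in> carrier W"
  shows "count_list (refls (s # u)) r = of_bool (s = r) + count_list (refls u) (s \<otimes> r \<otimes> s)"
  using count_refls_conj[OF assms(1) refls_carrier[OF assms(2)] assms(3)] by (cases "s = r") auto

lemma refls_relator:
  assumes "s \<in> S" "t \<in> S"
  shows "refls (concat (replicate k [s, t])) = map (\<lambda>i. (s \<otimes> t) [^] i \<otimes> s) [0..<2 * k]"
proof (induction k)
  case (Suc k)
  have st: "s \<otimes> t \<in> carrier W" using assms by simp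
  \<comment> \<open>Conjugating by \<open>t\<close> and then by \<open>s\<close> raises the exponent
    of \<open>s \<otimes> t\<close> by 2, which shifts the index list by 2.\<close>
  have "s \<otimes> (t \<otimes> ((s \<otimes> t) [^] i \<otimes> s) \<otimes> t) \<otimes> s = (s \<otimes> t) [^] (i + 2) \<otimes> s" for i :: nat
  proof -
    have "s \<otimes> (t \<otimes> ((s \<otimes> t) [^] i \<otimes> s) \<otimes> t) \<otimes> s = (s \<otimes> t) \<otimes> (s \<otimes> t) [^] i \<otimes> (s \<otimes> t) \<otimes> s"
      using assms st by (simp add: m_assoc)
    also have "(s \<otimes> t) \<otimes> (s \<otimes> t) [^] i = (s \<otimes> t) [^] Suc i"
      using st by (simp only: nat_pow_Suc2)
    finally show ?thesis using st by simp
  qed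
  moreover have "[0..<2 * Suc k] = 0 # 1 # map (\<lambda>i. i + 2) [0..<2 * k]"
    unfolding map_add_upt by (simp add: upt_conv_Cons numeral_2_eq_2 del: upt_Suc)
  ultimately show ?case
    using assms by (simp add: Suc comp_def)
qed simp

text \<open>The reflections (s t)^i s have period m in i, so the 2m entries are one list written
  twice. For infinite order m is 0 and the word is empty.\<close>

lemma even_count_relator:
  assumes "s \<in> S" "t \<in> S"
  shows "even (count_list (refls (concat (replicate (coxeter_m W s t) [s, t]))) r)"
proof -
  define m where "m = coxeter_m W s t"
  define f where "f = (\<lambda>i. (s \<otimes> t) [^] (i::nat) \<otimes> s)"
  have st: "s \<otimes> t \<in> carrier W" using assms by simp
  have "(s \<otimes> t) [^] m = \<one>" using st unfolding m_def coxeter_m_def by simp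
  then have f: "f (i + m) = f i" for i
    using st assms by (simp add: f_def nat_pow_mult[symmetric])
  have "[0..<2 * m] = [0..<m] @ map (\<lambda>i. i + m) [0..<m]"
    using upt_add_eq_append[of 0 m m] by (simp add: map_add_upt mult_2)
  then have "map f [0..<2 * m] = map f [0..<m] @ map f [0..<m]"
    by (simp add: f)
  then show ?thesis using refls_relator[OF assms] by (simp add: f_def m_def)
qed

lemma pr_relator:
  assumes "s \<in> S" "t \<in> S"
  shows "pr (concat (replicate (coxeter_m W s t) [s, t])) = \<one>"
proof -
  have "pr (concat (replicate k [s, t])) = (s \<otimes> t) [^] k" for k
  proof (induction k)
    case (Suc k)
    have "s \<otimes> t \<in> carrier W" using assms by simp
    then have "(s \<otimes> t) [^] Suc k = (s \<otimes> t) \<otimes> (s \<otimes> t) [^] k" by (rule nat_pow_Suc2)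
    then show ?case using Suc assms by (simp add: m_assoc)
  qed simp
  then show ?thesis using assms by (simp add: coxeter_m_def)
qed

lemma odd_count_append:
  assumes "u \<in> lists S" "v \<in> lists S" "v' \<in> lists S"
    and "\<And>r. r \<in> carrier W \<Longrightarrow> odd (count_list (refls v) r) = odd (count_list (refls v') r)"
    and "r \<in> carrier W"
  shows "odd (count_list (refls (u @ v)) r) = odd (count_list (refls (u @ v')) r)"
  using assms(1,5)
proof (induction u arbitrary: r)
  case Nil
  then show ?case using assms(4) by simp
next
  case (Cons s u)
  then have s: "s \<in> S" "u @ v \<in> lists S" "u @ v' \<in> lists S" using assms by auto
  with Cons show ?case
    by (simp add: count_refls_Cons del: refls.simps append_in_lists_conv)
qed

lemma odd_count_relator_append:
  assumes "u \<in> lists S" "v \<in> lists S" "pr u = \<one>"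
    and "\<And>r. even (count_list (refls u) r)" and "r \<in> carrier W"
  shows "odd (count_list (refls (u @ v)) r) = odd (count_list (refls v) r)"
proof -
  \<comment> \<open>Cocycle identity for a concatenation; since \<open>pr u = \<one>\<close>, the
    conjugation in the second summand disappears afterwards.\<close>
  have "count_list (refls (u @ v)) r
      = count_list (refls u) r + count_list (refls v) (inv (pr u) \<otimes> r \<otimes> pr u)"
    using assms(1,2,5)
  proof (induction u arbitrary: r)
    case (Cons s u)
    then have s: "s \<in> S" "u \<in> lists S" "u @ v \<in> lists S" by auto
    have "inv (pr (s # u)) \<otimes> r \<otimes> pr (s # u) = inv (pr u) \<otimes> (s \<otimes> r \<otimes> s) \<otimes> pr u"
      using s Cons.prems by (simp add: inv_mult_group m_assoc)
    with Cons s show ?case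
      by (simp add: count_refls_Cons del: refls.simps append_in_lists_conv pr_Cons)
  qed simp
  with assms show ?thesis by simp
qed

text \<open>Once relator moves preserve the set of reflections of odd multiplicity and the parity of
  the length, \<open>presentation\<close> makes both depend on the group element alone.\<close>

lemma relator_step_invariant:
  assumes "relator_step W S u v"
  shows "{r \<in> carrier W. odd (count_list (refls u) r)} = {r \<in> carrier W. odd (count_list (refls v) r)}"
    and "even (length u) = even (length v)"
proof -
  obtain s t x y where *: "s \<in> S" "t \<in> S" "x \<in> lists S" "y \<in> lists S"
      "u = x @ concat (replicate (coxeter_m W s t) [s, t]) @ y" "v = x @ y"
    using assms by cases auto
  let ?k = "concat (replicate (coxeter_m W s t) [s, t])"
  have k: "concat (replicate n [s, t]) \<in> lists S" for n using * by (induction n) auto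
  have len: "length (concat (replicate n [s, t])) = 2 * n" for n
    by (induction n) auto
  show "even (length u) = even (length v)" using * len by simp
  have "odd (count_list (refls u) r) = odd (count_list (refls v) r)" if "r \<in> carrier W" for r
    unfolding *
  proof (rule odd_count_append)
    show "odd (count_list (refls (?k @ y)) r) = odd (count_list (refls y) r)" if "r \<in> carrier W" for r
      by (rule odd_count_relator_append) (use * k that pr_relator even_count_relator in auto)
  qed (use * k that in auto)
  then show "{r \<in> carrier W. odd (count_list (refls u) r)} = {r \<in> carrier W. odd (count_list (refls v) r)}"
    by auto
qed

lemma odd_count_cong:
  assumes "u \<in> lists S" "v \<in> lists S" "pr u = pr v" "r \<in> carrier W"
  shows "odd (count_list (refls u) r) = odd (count_list (refls v) r)"
  using equivclp_invariant[OF presentation[OF assms(1-3)],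
      of "\<lambda>u. {r \<in> carrier W. odd (count_list (refls u) r)}"] relator_step_invariant(1) assms(4) by blast

lemma parity_cong:
  assumes "u \<in> lists S" "v \<in> lists S" "pr u = pr v"
  shows "even (length u) = even (length v)"
  using equivclp_invariant[OF presentation[OF assms], of "\<lambda>u. even (length u)"]
    relator_step_invariant(2) by blast

text \<open>Left multiplication by the i-th reflection of a word cancels its i-th letter.\<close>

lemma delete_reflection:
  assumes "u \<in> lists S" "r \<in> set (refls u)"
  shows "\<exists>x a y. u = x @ a # y \<and> r \<otimes> pr u = pr (x @ y)"
  using assms
proof (induction u arbitrary: r)
  case (Cons s u)
  then have s: "s \<in> S" "u \<in> lists S" by auto
  show ?case
  proof (cases "r = s")
    case True
    then show ?thesis using s by (intro exI[of _ "[]"]) simp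
  next
    case False
    then obtain t where t: "t \<in> set (refls u)" "r = s \<otimes> t \<otimes> s" using Cons.prems by auto
    then obtain x a y where "u = x @ a # y" "t \<otimes> pr u = pr (x @ y)" using Cons.IH s by blast
    moreover have "t \<in> carrier W" using t refls_carrier s by auto
    ultimately have "s # u = (s # x) @ a # y" "r \<otimes> pr (s # u) = pr ((s # x) @ y)"
      using s t by (simp_all add: m_assoc)
    then show ?thesis by blast
  qed
qed simp

text \<open>The first collision found from the right is one of the head with a tail entry, because
  conjugation is injective. The head \<open>s\<close> is then a reflection of the tail, and deleting
  the corresponding letter turns the whole word into one that is shorter by two.\<close>

lemma not_distinct_refls:
  assumes "u \<in> lists S" "\<not> distinct (refls u)"
  shows "\<exists>v\<in>lists S. length v < length u \<and> pr v = pr u"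
  using assms
proof (induction u)
  case (Cons s u)
  then have s: "s \<in> S" "u \<in> lists S" by auto
  have c: "set (refls u) \<subseteq> carrier W" using refls_carrier s by auto
  show ?case
  proof (cases "distinct (refls u)")
    case False
    with Cons s obtain v where "v \<in> lists S" "length v < length u" "pr v = pr u" by auto
    then show ?thesis using s by (intro bexI[of _ "s # v"]) auto
  next
    case True
    have "inj_on (\<lambda>t. s \<otimes> t \<otimes> s) (set (refls u))"
      using conj_S_inj s c by (intro inj_onI) blast
    with True Cons.prems obtain t where t: "t \<in> set (refls u)" "s = s \<otimes> t \<otimes> s"
      by (auto simp: distinct_map)
    have "t = s" using conj_S_inj[of s t s] s c t by auto
    with t delete_reflection[of u s] s obtain x a y where
      *: "u = x @ a # y" "s \<otimes> pr u = pr (x @ y)" by auto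
    then have "x @ y \<in> lists S" using s by auto
    then show ?thesis using * by (intro bexI[of _ "x @ y"]) auto
  qed
qed simp

text \<open>Relators have even length, so the parity of the length is a sign character that every
  generator reverses.\<close>

lemma len_parity:
  assumes "s \<in> S" "w \<in> carrier W"
  shows "even (len (s \<otimes> w)) \<noteq> even (len w)" "even (len (w \<otimes> s)) \<noteq> even (len w)"
proof -
  obtain u where u: "u \<in> lists S" "length u = len w" "pr u = w" using ex_reduced assms by meson
  obtain v where v: "v \<in> lists S" "length v = len (s \<otimes> w)" "pr v = s \<otimes> w"
    using ex_reduced assms by (meson S_closed m_closed)
  show "even (len (s \<otimes> w)) \<noteq> even (len w)"
    using parity_cong[of "s # u" v] assms u v by auto
  obtain v where v: "v \<in> lists S" "length v = len (w \<otimes> s)" "pr v = w \<otimes> s"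
    using ex_reduced assms by (meson S_closed m_closed)
  show "even (len (w \<otimes> s)) \<noteq> even (len w)"
    using parity_cong[of "u @ [s]" v] assms u v by (auto simp: pr_append)
qed

lemma len_left_cases:
  assumes "s \<in> S" "w \<in> carrier W"
  shows "len (s \<otimes> w) = Suc (len w) \<or> len w = Suc (len (s \<otimes> w))"
  using len_parity(1)[OF assms] len_mult[of s w] len_mult[of s "s \<otimes> w"] assms
  by (cases "len (s \<otimes> w) = len w") auto

lemma len_right_cases:
  assumes "s \<in> S" "w \<in> carrier W"
  shows "len (w \<otimes> s) = Suc (len w) \<or> len w = Suc (len (w \<otimes> s))"
  using len_parity(2)[OF assms] len_mult[of w s] len_mult[of "w \<otimes> s" s] assms
  by (cases "len (w \<otimes> s) = len w") auto

text \<open>A reduced word \<open>v\<close> of \<open>s \<otimes> pr u\<close> gives a reduced word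
  \<open>s # v\<close> of \<open>pr u\<close>, in which \<open>s\<close> occurs exactly once as a
  reflection. Parity carries this over to \<open>u\<close>, where \<open>s\<close> must therefore
  occur and \<open>delete_reflection\<close> applies.\<close>

lemma exchange_left:
  assumes "s \<in> S" "u \<in> lists S" "len (s \<otimes> pr u) < len (pr u)"
  shows "\<exists>x a y. u = x @ a # y \<and> s \<otimes> pr u = pr (x @ y)"
proof -
  have c: "pr u \<in> carrier W" using assms by simp
  obtain v where v: "v \<in> lists S" "length v = len (s \<otimes> pr u)" "pr v = s \<otimes> pr u"
    using ex_reduced assms(1) c by (meson S_closed m_closed)
  have sv: "s # v \<in> lists S" "pr (s # v) = pr u" using v assms c by auto
  have "len (pr u) = length (s # v)" using len_left_cases[OF assms(1) c] assms(3) v by simp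
  then have "distinct (refls (s # v))"
    using not_distinct_refls[OF sv(1)] sv(2) len_le by fastforce
  then have "count_list (refls (s # v)) s = 1" by (auto simp: count_list_0_iff)
  then have "odd (count_list (refls u) s)"
    using odd_count_cong[of u "s # v" s] sv assms by auto
  then have "s \<in> set (refls u)" by (metis count_list_0_iff even_zero)
  then show ?thesis using delete_reflection assms by blast
qed

lemma exchange_right:
  assumes "s \<in> S" "u \<in> lists S" "len (pr u \<otimes> s) < len (pr u)"
  shows "\<exists>x a y. u = x @ a # y \<and> pr u \<otimes> s = pr (x @ y)"
proof -
  have c: "pr u \<in> carrier W" "s \<in> carrier W" "rev u \<in> lists S" using assms by auto
  have e: "s \<otimes> pr (rev u) = inv (pr u \<otimes> s)"
    using c assms by (simp add: pr_rev inv_mult_group)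
  then have "len (s \<otimes> pr (rev u)) < len (pr (rev u))"
    using c assms by (simp add: pr_rev)
  from exchange_left[OF assms(1) c(3) this] obtain x a y where
    *: "rev u = x @ a # y" "s \<otimes> pr (rev u) = pr (x @ y)" by blast
  then have u: "u = rev y @ a # rev x" by (simp add: rev_swap)
  then have xy: "x @ y \<in> lists S" using assms by auto
  have "pr u \<otimes> s = inv (inv (pr u \<otimes> s))" using c by simp
  also have "\<dots> = pr (rev y @ rev x)" using pr_rev[OF xy] * e by simp
  finally show ?thesis using u by blast
qed

subsection \<open>Parabolic subgroups and supports\<close>

text \<open>Putting a letter of \<open>J\<close> in front of a reduced word over \<open>J\<close>
  either keeps it reduced or, by exchange, deletes one of its letters; no letter outside
  \<open>J\<close> ever enters.\<close>

lemma par_ex_reduced: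
  assumes "J \<subseteq> S" "w \<in> par J"
  shows "\<exists>v\<in>lists J. reduced v \<and> pr v = w"
proof -
  have "\<exists>v\<in>lists J. reduced v \<and> pr v = pr u" if "u \<in> lists J" for u
    using that
  proof (induction u)
    case Nil
    show ?case by (intro bexI[of _ "[]"]) (auto simp: reduced_def)
  next
    case (Cons s u)
    then obtain v where v: "v \<in> lists J" "reduced v" "pr v = pr u" by auto
    have s: "s \<in> J" "s \<in> S" "v \<in> lists S" using Cons v assms by (auto simp: reduced_def)
    then have c: "pr v \<in> carrier W" by simp
    show ?case
    proof (cases "len (s \<otimes> pr v) < len (pr v)")
      case True
      with exchange_left s obtain x a y where *: "v = x @ a # y" "s \<otimes> pr v = pr (x @ y)" by blast
      moreover have "len (pr v) = Suc (len (s \<otimes> pr v))" using len_left_cases[of s "pr v"] True s c by simp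
      ultimately have "reduced (x @ y)" using v by (auto simp: reduced_def)
      then show ?thesis using * v by (intro bexI[of _ "x @ y"]) auto
    next
      case False
      then have "len (s \<otimes> pr v) = Suc (len (pr v))" using len_left_cases[of s "pr v"] s c by auto
      then show ?thesis using s v by (intro bexI[of _ "s # v"]) (auto simp: reduced_def)
    qed
  qed
  then show ?thesis using assms pr_eq_generate by auto
qed

lemma reduced_ConsD:
  assumes "reduced (s # u)"
  shows "s \<in> S" "reduced u" "len (s \<otimes> pr (s # u)) < len (pr (s # u))"
proof -
  show s: "s \<in> S" using assms by (auto simp: reduced_def)
  have u: "u \<in> lists S" using assms by (auto simp: reduced_def)
  then have c: "pr u \<in> carrier W" by simp
  have "len (pr u) \<le> length u" "len (s \<otimes> pr u) = Suc (length u)"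
    using u len_le assms by (auto simp: reduced_def)
  then show "reduced u" using len_left_cases[OF s c] u by (auto simp: reduced_def)
  then show "len (s \<otimes> pr (s # u)) < len (pr (s # u))"
    using s c \<open>len (s \<otimes> pr u) = _\<close> by (simp add: reduced_def)
qed

lemma S_in_par_iff: "\<lbrakk>J \<subseteq> S; s \<in> S\<rbrakk> \<Longrightarrow> s \<in> par J \<longleftrightarrow> s \<in> J"
proof
  assume J: "J \<subseteq> S" "s \<in> S" "s \<in> par J"
  then obtain v where v: "v \<in> lists J" "reduced v" "pr v = s" using par_ex_reduced by blast
  then have "length v = 1" using J by (simp add: reduced_def)
  then obtain a where "v = [a]" by (auto simp: length_Suc_conv)
  then show "s \<in> J" using v J by auto
qed (rule par_gen)

text \<open>Exchange the first letter \<open>s\<close> of \<open>u\<close> against a reduced word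
  over \<open>J\<close> of the same element: the tail then lies in the subgroup of \<open>J\<close>,
  hence so does \<open>s\<close>, and \<open>S_in_par_iff\<close> puts it into
  \<open>J\<close>.\<close>

lemma par_reduced:
  assumes "J \<subseteq> S" "reduced u" "pr u \<in> par J"
  shows "u \<in> lists J"
  using assms(2,3)
proof (induction u)
  case (Cons s u)
  note s = reduced_ConsD[OF Cons.prems(1)]
  obtain v where v: "v \<in> lists J" "reduced v" "pr v = pr (s # u)"
    using par_ex_reduced assms Cons by blast
  then have "len (s \<otimes> pr v) < len (pr v)" "v \<in> lists S" using s by (auto simp: reduced_def)
  with exchange_left s obtain x a y where *: "v = x @ a # y" "s \<otimes> pr v = pr (x @ y)" by blast
  have c: "pr u \<in> carrier W" using s by (auto simp: reduced_def)
  have "x @ y \<in> lists J" using v * by auto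
  then have u: "pr u \<in> par J" using * pr_in_par[OF assms(1)] v(3) s c by (metis S_cancel pr_Cons)
  then have "s \<otimes> pr u \<otimes> inv (pr u) \<in> par J" using Cons.prems par_inv par_mult assms by simp
  then have "s \<in> par J" using s c by (simp add: m_assoc)
  then show ?case using S_in_par_iff assms s Cons.IH u by simp
qed simp

text \<open>Apply \<open>par_reduced\<close> with the letters of one reduced word as
  \<open>J\<close>: no other reduced word can contribute a new letter.\<close>

lemma support_reduced: "reduced u \<Longrightarrow> support W S (pr u) = set u"
proof
  assume u: "reduced u"
  then have S: "set u \<subseteq> S" by (auto simp: reduced_def)
  have "v \<in> lists (set u)" if "v \<in> lists S" "pr v = pr u" "length v = len (pr u)" for v
    using par_reduced[of "set u" v] S pr_in_par[of "set u" u] that by (auto simp: reduced_def)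
  then show "support W S (pr u) \<subseteq> set u" by (auto simp: support_def)
  show "set u \<subseteq> support W S (pr u)" using u by (auto simp: support_def reduced_def)
qed

lemma obtain_reduced:
  assumes "w \<in> carrier W"
  obtains u where "reduced u" "pr u = w" "u \<in> lists S" "length u = len w" "set u = support W S w"
  using ex_reduced[OF assms] support_reduced unfolding reduced_def by metis

lemma support_subset_S: "support W S w \<subseteq> S"
  by (auto simp: support_def)

lemma support_subset_iff:
  assumes "J \<subseteq> S" "w \<in> carrier W"
  shows "support W S w \<subseteq> J \<longleftrightarrow> w \<in> par J"
proof -
  obtain u where "reduced u" "pr u = w" "u \<in> lists S" "set u = support W S w"
    using obtain_reduced assms by metis
  then show ?thesis using par_reduced[OF assms(1), of u] pr_in_par[OF assms(1), of u] by auto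
qed

lemma in_par_support: "w \<in> carrier W \<Longrightarrow> w \<in> par (support W S w)"
  using support_subset_iff[OF support_subset_S] by blast

lemma support_mult:
  assumes "x \<in> carrier W" "y \<in> carrier W" "len (x \<otimes> y) = len x + len y"
  shows "support W S (x \<otimes> y) = support W S x \<union> support W S y"
proof -
  obtain u v where u: "reduced u" "pr u = x" "u \<in> lists S" "length u = len x" "set u = support W S x"
    and v: "reduced v" "pr v = y" "v \<in> lists S" "length v = len y" "set v = support W S y"
    using obtain_reduced assms by metis
  have uv: "pr (u @ v) = x \<otimes> y" using pr_append_S u v by auto
  have "reduced (u @ v)" using u v assms uv by (auto simp: reduced_def)
  then show ?thesis using support_reduced[of "u @ v"] u v uv by auto
qed

lemma support_inv:
  assumes "x \<in> carrier W"
  shows "support W S (inv x) = support W S x"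
proof -
  obtain u where u: "reduced u" "pr u = x" "u \<in> lists S" "length u = len x" "set u = support W S x"
    using obtain_reduced assms by metis
  then have "reduced (rev u)" "pr (rev u) = inv x"
    using assms by (auto simp: reduced_def pr_rev)
  then show ?thesis using support_reduced[of "rev u"] u by auto
qed

subsection \<open>Descents\<close>

lemma right_descents_iff:
  "w \<in> carrier W \<Longrightarrow> s \<in> right_descents W S w \<longleftrightarrow> s \<in> S \<and> len w = Suc (len (w \<otimes> s))"
  using len_right_cases[of s w] by (auto simp: right_descents_def)

lemma descents_inv:
  assumes "w \<in> carrier W"
  shows "right_descents W S (inv w) = left_descents W S w"
    and "left_descents W S (inv w) = right_descents W S w"
proof -
  have "len (inv w \<otimes> s) = len (s \<otimes> w)" "len (s \<otimes> inv w) = len (w \<otimes> s)" if "s \<in> S" for s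
    using that assms len_inv[of "s \<otimes> w"] len_inv[of "w \<otimes> s"] by (auto simp: inv_mult_group)
  then show "right_descents W S (inv w) = left_descents W S w"
    "left_descents W S (inv w) = right_descents W S w"
    using assms by (auto simp: left_descents_def right_descents_def)
qed

text \<open>Exchange writes \<open>s \<otimes> w\<close> as a subword of a reduced word of
  \<open>w\<close>, so \<open>s\<close> itself lies in the parabolic subgroup of the
  support.\<close>

lemma left_descents_support:
  assumes "w \<in> carrier W"
  shows "left_descents W S w \<subseteq> support W S w"
proof
  fix s assume s: "s \<in> left_descents W S w"
  obtain u where u: "reduced u" "pr u = w" "u \<in> lists S" "set u = support W S w"
    using obtain_reduced assms by metis
  have sS: "s \<in> S" using s by (simp add: left_descents_def)
  then obtain x a y where *: "u = x @ a # y" "s \<otimes> w = pr (x @ y)"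
    using exchange_left[of s u] s u by (auto simp: left_descents_def)
  have "set (x @ y) \<subseteq> set u" "set u \<subseteq> S" using * u by auto
  then have "s \<otimes> w \<in> par (set u)" "w \<in> par (set u)"
    using pr_in_par[of "set u" "x @ y"] pr_in_par[of "set u" u] * u by auto
  then have "s \<otimes> w \<otimes> inv w \<in> par (set u)"
    using \<open>set u \<subseteq> S\<close> par_mult par_inv by blast
  then show "s \<in> support W S w"
    using S_in_par_iff[of "set u" s] \<open>set u \<subseteq> S\<close> sS assms u by (simp add: m_assoc)
qed

lemma right_descents_support: "w \<in> carrier W \<Longrightarrow> right_descents W S w \<subseteq> support W S w"
  using left_descents_support[of "inv w"] by (simp add: descents_inv support_inv)

lemma descents_par:
  assumes "J \<subseteq> S" "w \<in> par J"
  shows "left_descents W S w \<subseteq> J" "right_descents W S w \<subseteq> J"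
  using assms par_carrier[OF assms] support_subset_iff left_descents_support right_descents_support
  by blast+

text \<open>Exchange on concatenated reduced words of \<open>x\<close> and \<open>y\<close>: the
  deleted letter belongs to \<open>y\<close> in the first case and to \<open>x\<close> in the
  second. As \<open>x'\<close> is a subword of a reduced word of \<open>x\<close>, it stays in every
  parabolic subgroup containing \<open>x\<close>.\<close>

lemma exchange_product:
  assumes "x \<in> carrier W" "y \<in> carrier W" "s \<in> S" "len (x \<otimes> y \<otimes> s) < len (x \<otimes> y)"
  obtains "len (y \<otimes> s) < len y"
  | x' where "x' \<in> carrier W" "len x' < len x" "x \<otimes> y \<otimes> s = x' \<otimes> y"
      "\<And>J. \<lbrakk>J \<subseteq> S; x \<in> par J\<rbrakk> \<Longrightarrow> x' \<in> par J"
proof -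
  obtain u v where u: "reduced u" "pr u = x" "u \<in> lists S" "length u = len x" "set u = support W S x"
    and v: "reduced v" "pr v = y" "v \<in> lists S" "length v = len y" "set v = support W S y"
    using obtain_reduced assms by metis
  have uv: "pr (u @ v) = x \<otimes> y" "u @ v \<in> lists S" using pr_append_S u v by auto
  from exchange_right[of s "u @ v"] assms uv obtain p a q where
    *: "u @ v = p @ a # q" "x \<otimes> y \<otimes> s = pr (p @ q)" by auto
  consider r where "u = p @ a # r" "q = r @ v" | r where "p = u @ r" "v = r @ a # q"
    using *(1) by (auto simp: append_eq_append_conv2 append_eq_Cons_conv Cons_eq_append_conv)
  then show thesis
  proof cases
    case 1
    have "p @ r \<in> lists S" using u 1 by auto
    then have "x \<otimes> y \<otimes> s = pr (p @ r) \<otimes> y" "len (pr (p @ r)) < len x" "pr (p @ r) \<in> carrier W"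
      using * 1 u v len_le[of "p @ r"] pr_append_S[of "p @ r" v] by auto
    moreover have "pr (p @ r) \<in> par J" if "J \<subseteq> S" "x \<in> par J" for J
      using par_reduced[of J u] that u 1 pr_in_par[of J "p @ r"] by auto
    ultimately show ?thesis using that(2) by blast
  next
    case 2
    have r: "r @ q \<in> lists S" using v 2 by auto
    then have "x \<otimes> (y \<otimes> s) = x \<otimes> pr (r @ q)"
      using * 2 u v assms pr_append_S[OF u(3) r] by (simp add: m_assoc)
    then have "y \<otimes> s = pr (r @ q)" using r assms by (subst (asm) l_cancel) auto
    then have "len (y \<otimes> s) < len y" using len_le[OF r] 2 v by simp
    then show ?thesis using that(1) by blast
  qed
qed

subsection \<open>Minimal coset representatives\<close>

lemma ex_right_descent:
  assumes "J \<subseteq> S" "w \<in> par J" "w \<noteq> \<one>"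
  obtains s where "s \<in> J" "w \<otimes> s \<in> par J" "len w = Suc (len (w \<otimes> s))"
proof -
  have c: "w \<in> carrier W" "inv w \<in> par J" "inv w \<noteq> \<one>"
    using assms par_carrier par_inv inv_eq_1_iff by auto
  then obtain v where v: "v \<in> lists J" "reduced v" "pr v = inv w"
    using par_ex_reduced assms by blast
  with assms c obtain s v' where sv: "v = s # v'" by (metis list.exhaust pr_Nil)
  then have s: "s \<in> J" "s \<in> S" using v assms by auto
  have "len (s \<otimes> inv w) < len (inv w)" using reduced_ConsD[of s v'] v sv by auto
  then have "s \<in> left_descents W S (inv w)" using s by (simp add: left_descents_def)
  then have "s \<in> right_descents W S w" using descents_inv c by simp
  then have "len w = Suc (len (w \<otimes> s))" using right_descents_iff c by simp
  then show ?thesis using that s par_mult par_gen assms by blast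
qed

lemma par_induct [consumes 2, case_names one step]:
  assumes "J \<subseteq> S" "w \<in> par J"
    and one: "P \<one>"
    and step: "\<And>w s. \<lbrakk>w \<in> par J; s \<in> J; len (w \<otimes> s) = Suc (len w); P w\<rbrakk> \<Longrightarrow> P (w \<otimes> s)"
  shows "P w"
  using assms(2)
proof (induction "len w" arbitrary: w rule: less_induct)
  case less
  show ?case
  proof (cases "w = \<one>")
    case False
    with less ex_right_descent[OF assms(1)] obtain s where
      s: "s \<in> J" "w \<otimes> s \<in> par J" "len w = Suc (len (w \<otimes> s))" by metis
    then have "P (w \<otimes> s)" using less by simp
    moreover have "w \<otimes> s \<otimes> s = w" using s less.prems assms(1) par_carrier[OF assms(1), of w] by auto
    ultimately show ?thesis using step[of "w \<otimes> s" s] s by simp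
  qed (use one in auto)
qed

text \<open>If appending \<open>s\<close> shortened \<open>v \<otimes> u\<close> while it lengthens
  \<open>u\<close>, exchange would delete a letter of \<open>v\<close>. The result \<open>x'\<close>
  would be \<open>v\<close> times a conjugate of \<open>s\<close> in the subgroup, a shorter element
  of the same coset.\<close>

lemma len_mult_minimal:
  assumes "J \<subseteq> S" "v \<in> carrier W" "\<And>u. u \<in> par J \<Longrightarrow> len v \<le> len (v \<otimes> u)" "u \<in> par J"
  shows "len (v \<otimes> u) = len v + len u"
  using assms(1,4)
proof (induction rule: par_induct)
  case (step u s)
  have c: "u \<in> carrier W" "s \<in> S" using step assms par_carrier by auto
  have "\<not> len (v \<otimes> u \<otimes> s) < len (v \<otimes> u)"
  proof
    assume "len (v \<otimes> u \<otimes> s) < len (v \<otimes> u)"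
    from assms(2) c this show False
    proof (cases rule: exchange_product)
      case (2 x')
      have "v \<otimes> (u \<otimes> s \<otimes> inv u) = x'"
      proof -
        have "v \<otimes> (u \<otimes> s \<otimes> inv u) = (v \<otimes> u \<otimes> s) \<otimes> inv u" using c assms by (simp add: m_assoc)
        also have "\<dots> = x'" unfolding 2(3) using 2(1) c by (simp add: m_assoc)
        finally show ?thesis .
      qed
      moreover have "u \<otimes> s \<otimes> inv u \<in> par J"
        using step assms by (meson par_mult par_inv par_gen)
      ultimately show False using assms(3) 2 by fastforce
    qed (use step in auto)
  qed
  then have "len (v \<otimes> u \<otimes> s) = Suc (len (v \<otimes> u))"
    using len_right_cases[of s "v \<otimes> u"] c assms by auto
  then show ?case using step c assms by (simp add: m_assoc)
qed (use assms in auto)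

text \<open>Pass to a shortest element \<open>v \<otimes> x\<close> of the coset. Lengths add in
  \<open>v = (v \<otimes> x) \<otimes> inv x\<close>, so a right descent of a nontrivial
  \<open>inv x\<close> would be a right descent of \<open>v\<close> in \<open>J\<close>.\<close>

lemma len_mult_right:
  assumes "J \<subseteq> S" "v \<in> carrier W" "right_descents W S v \<inter> J = {}" "u \<in> par J"
  shows "len (v \<otimes> u) = len v + len u"
proof -
  obtain x where x: "x \<in> par J" "\<And>u. u \<in> par J \<Longrightarrow> len (v \<otimes> x) \<le> len (v \<otimes> u)"
    using ex_has_least_nat[of "\<lambda>x. x \<in> par J" \<one> "\<lambda>x. len (v \<otimes> x)"] generate.one[of W J] by blast
  have c: "x \<in> carrier W" using x assms par_carrier by auto
  have add: "len (v \<otimes> x \<otimes> y) = len (v \<otimes> x) + len y" if "y \<in> par J" for y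
  proof (rule len_mult_minimal[OF assms(1) _ _ that])
    show "len (v \<otimes> x) \<le> len (v \<otimes> x \<otimes> u)" if "u \<in> par J" for u
      using x(2)[of "x \<otimes> u"] that x(1) c assms par_mult par_carrier[OF assms(1) that] by (simp add: m_assoc)
  qed (use c assms in auto)
  have "inv x = \<one>"
  proof (rule ccontr)
    assume "inv x \<noteq> \<one>"
    then obtain s where s: "s \<in> J" "inv x \<otimes> s \<in> par J" "len (inv x) = Suc (len (inv x \<otimes> s))"
      using ex_right_descent[of J "inv x"] assms x par_inv by metis
    have sS: "s \<in> S" using s assms by auto
    have "len v = len (v \<otimes> x) + len (inv x)" "len (v \<otimes> s) = len (v \<otimes> x) + len (inv x \<otimes> s)"
      using add[of "inv x"] add[of "inv x \<otimes> s"] s sS x assms c par_inv by (auto simp: m_assoc inv_solve_left' simp flip: m_assoc[of x])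
    then have "s \<in> right_descents W S v" using s sS assms right_descents_iff by simp
    then show False using assms s by auto
  qed
  then have "x = \<one>" using c inv_eq_1_iff by blast
  then show ?thesis using add[OF assms(4)] assms by simp
qed

lemma len_mult_left:
  assumes "J \<subseteq> S" "v \<in> carrier W" "left_descents W S v \<inter> J = {}" "u \<in> par J"
  shows "len (u \<otimes> v) = len u + len v"
proof -
  have "u \<in> carrier W" using assms par_carrier by auto
  then show ?thesis
    using len_mult_right[of J "inv v" "inv u"] assms par_inv len_inv[of "u \<otimes> v"]
    by (simp add: descents_inv inv_mult_group)
qed

subsection \<open>Longest elements\<close>

text \<open>Induction along \<open>z\<close>: if w = x z is length additive and \<open>s\<close> is
  a descent of \<open>w\<close> but not of \<open>z\<close>, then exchange removes a letter of x,
  which gives w = x' (z s) with x' shorter by one.\<close>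

lemma right_descents_factor:
  assumes "J \<subseteq> S" "w \<in> carrier W" "J \<subseteq> right_descents W S w" "z \<in> par J"
  shows "len (w \<otimes> inv z) + len z = len w"
  using assms(1,4)
proof (induction rule: par_induct)
  case (step z s)
  have c: "z \<in> carrier W" "s \<in> S" using step assms par_carrier by auto
  define x where "x = w \<otimes> inv z"
  have x: "x \<in> carrier W" "x \<otimes> z = w" using c assms by (auto simp: x_def m_assoc)
  have "len (x \<otimes> z \<otimes> s) < len (x \<otimes> z)" using step assms x by (auto simp: right_descents_def)
  with x(1) c show ?case
  proof (cases rule: exchange_product)
    case (2 x')
    have "w = x' \<otimes> (z \<otimes> s)" using 2 x c assms by (metis S_cancel_right m_assoc S_closed)
    then have w: "w \<otimes> inv (z \<otimes> s) = x'" "len w \<le> len x' + len (z \<otimes> s)"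
      using 2 c len_mult[of x' "z \<otimes> s"] by (auto simp: m_assoc simp del: inv_mult_group)
    then show ?thesis using 2 step by (simp add: x_def)
  qed (use step in auto)
qed (use assms in auto)

lemma left_descents_factor:
  assumes "J \<subseteq> S" "w \<in> carrier W" "J \<subseteq> left_descents W S w" "z \<in> par J"
  shows "len (inv z \<otimes> w) + len z = len w"
proof -
  have "z \<in> carrier W" using assms par_carrier by auto
  then show ?thesis
    using right_descents_factor[of J "inv w" "inv z"] assms par_inv len_inv[of "inv z \<otimes> w"]
    by (simp add: descents_inv inv_mult_group)
qed

text \<open>Bounded length takes the place of finiteness: a maximal length is all that a longest
  element requires, and \<open>bounded_parI\<close> proves boundedness without counting elements,
  notably for commuting unions.\<close>

definition bounded_par :: "'a set \<Rightarrow> bool" where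
  "bounded_par J \<longleftrightarrow> J \<subseteq> S \<and> (\<exists>n. \<forall>w\<in>par J. len w \<le> n)"

abbreviation lg :: "'a set \<Rightarrow> 'a" where "lg \<equiv> longest_element W S"

lemma spherical_bounded_par:
  assumes "J \<subseteq> S" "spherical W J"
  shows "bounded_par J"
  using assms finite_nat_set_iff_bounded_le[of "len ` par J"] by (auto simp: bounded_par_def spherical_def)

lemma bounded_par_subset: "\<lbrakk>bounded_par K; J \<subseteq> K\<rbrakk> \<Longrightarrow> bounded_par J"
  unfolding bounded_par_def using par_mono by blast

lemma bounded_parI:
  assumes "J \<subseteq> S" "x \<in> par J" "J \<subseteq> right_descents W S x"
  shows "bounded_par J"
  unfolding bounded_par_def
proof (intro conjI exI ballI)
  fix w assume "w \<in> par J"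
  then show "len w \<le> len x" using right_descents_factor[of J x w] assms par_carrier by auto
qed (rule assms)

text \<open>By \<open>right_descents_factor\<close> every \<open>w\<close> in the subgroup is a
  reduced right factor of \<open>x\<close>, so \<open>x\<close> is longest; if \<open>w\<close> has
  the same length, the remaining factor has length 0. This is the criterion by which longest
  elements are identified.\<close>

lemma longest_element_eq:
  assumes "J \<subseteq> S" "x \<in> par J" "J \<subseteq> right_descents W S x"
  shows "lg J = x"
  unfolding longest_element_def
proof (rule the_equality)
  have c: "x \<in> carrier W" using assms par_carrier by auto
  have *: "len (x \<otimes> inv w) + len w = len x" if "w \<in> par J" for w
    using right_descents_factor[of J x w] that c assms by auto
  show "x \<in> par J \<and> (\<forall>w\<in>par J. len w \<le> len x)"
    using assms * by fastforce
  fix u assume u: "u \<in> par J \<and> (\<forall>w\<in>par J. len w \<le> len u)"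
  then have uc: "u \<in> carrier W" using assms par_carrier by auto
  have "len x \<le> len u" using u assms by auto
  then have "x \<otimes> inv u = \<one>" using *[of u] u uc c by (intro len_0D) auto
  then show "u = x" using uc c by (metis inv_equality inv_inv inv_closed)
qed

lemma
  assumes "bounded_par J"
  shows lg_par: "lg J \<in> par J" and lg_right_descents: "J \<subseteq> right_descents W S (lg J)"
proof -
  have J: "J \<subseteq> S" using assms by (simp add: bounded_par_def)
  obtain n where n: "\<And>w. w \<in> par J \<Longrightarrow> len w \<le> n" using assms unfolding bounded_par_def by blast
  obtain x where x: "x \<in> par J" "\<And>w. w \<in> par J \<Longrightarrow> len w \<le> len x"
    using ex_has_greatest_nat[of "\<lambda>w. w \<in> par J" \<one> len "Suc n"] generate.one[of W J] n
    by (metis less_Suc_eq_le)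
  have "s \<in> right_descents W S x" if "s \<in> J" for s
  proof -
    have "x \<in> carrier W" "s \<in> S" using that x J par_carrier by auto
    moreover have "len (x \<otimes> s) \<le> len x" using x that par_mult par_gen by blast
    ultimately show ?thesis using len_right_cases[of s x] by (auto simp: right_descents_def)
  qed
  then have "J \<subseteq> right_descents W S x" by blast
  then show "lg J \<in> par J" "J \<subseteq> right_descents W S (lg J)" using longest_element_eq[of J x] x J by auto
qed

lemma bounded_par_S: "bounded_par J \<Longrightarrow> J \<subseteq> S"
  by (simp add: bounded_par_def)

lemma lg_closed [simp]: "bounded_par J \<Longrightarrow> lg J \<in> carrier W"
  using lg_par bounded_par_S par_carrier by blast

text \<open>The inverse of u_J is itself a right factor of u_J; splitting off this factor of equal
  length leaves length 0 for the square of u_J.\<close>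

lemma lg_inv [simp]:
  assumes "bounded_par J"
  shows "inv (lg J) = lg J"
proof -
  have J: "J \<subseteq> S" "lg J \<in> par J" using assms bounded_par_S lg_par by auto
  have "len (lg J \<otimes> inv (inv (lg J))) + len (inv (lg J)) = len (lg J)"
    using right_descents_factor[OF J(1) _ lg_right_descents[OF assms] par_inv[OF J]] par_carrier[OF J] by simp
  then have "lg J \<otimes> lg J = \<one>" using assms by (intro len_0D) auto
  then show ?thesis using assms by (simp add: inv_equality)
qed

lemma lg_square [simp]: "bounded_par J \<Longrightarrow> lg J \<otimes> lg J = \<one>"
  using r_inv[of "lg J"] by simp

lemma lg_cancel [simp]: "\<lbrakk>bounded_par J; x \<in> carrier W\<rbrakk> \<Longrightarrow> lg J \<otimes> (lg J \<otimes> x) = x"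
  by (simp flip: m_assoc)

lemma lg_cancel_right [simp]: "\<lbrakk>bounded_par J; x \<in> carrier W\<rbrakk> \<Longrightarrow> x \<otimes> lg J \<otimes> lg J = x"
  by (simp add: m_assoc)

text \<open>Splitting off u_J leaves a minimal coset representative: for \<open>s\<close> in
  \<open>J\<close> the element u_J s is shorter by one and is split off as well, so w u_J s is
  longer than w u_J.\<close>

lemma lg_right_factor:
  assumes "bounded_par J" "w \<in> carrier W" "J \<subseteq> right_descents W S w"
  shows "len (w \<otimes> lg J) + len (lg J) = len w" "right_descents W S (w \<otimes> lg J) \<inter> J = {}"
proof -
  have J: "J \<subseteq> S" "lg J \<in> par J" using assms bounded_par_S lg_par by auto
  note * = right_descents_factor[OF J(1) assms(2,3)]
  show 1: "len (w \<otimes> lg J) + len (lg J) = len w" using *[of "lg J"] J assms by simp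
  have "s \<notin> right_descents W S (w \<otimes> lg J)" if "s \<in> J" for s
  proof -
    have s: "s \<in> S" "s \<in> carrier W" using that J by auto
    have "len (w \<otimes> (lg J \<otimes> s)) + len (lg J \<otimes> s) = len w"
      using *[of "inv (lg J \<otimes> s)"] J that par_mult par_gen par_inv s assms by simp
    moreover have "len (lg J) = Suc (len (lg J \<otimes> s))"
      using lg_right_descents[OF assms(1)] that right_descents_iff assms by auto
    ultimately show ?thesis using 1 assms s right_descents_iff[of "w \<otimes> lg J" s] by (simp add: m_assoc)
  qed
  then show "right_descents W S (w \<otimes> lg J) \<inter> J = {}" by blast
qed

lemma lg_left_factor:
  assumes "bounded_par J" "w \<in> carrier W" "J \<subseteq> left_descents W S w"
  shows "len (lg J \<otimes> w) + len (lg J) = len w" "left_descents W S (lg J \<otimes> w) \<inter> J = {}"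
  using lg_right_factor[of J "inv w"] assms len_inv[of "lg J \<otimes> w"] descents_inv[of "lg J \<otimes> w"]
  by (simp_all add: descents_inv inv_mult_group)

subsection \<open>Commuting generators\<close>

definition commuting :: "'a set \<Rightarrow> 'a set \<Rightarrow> bool" where
  "commuting J K \<longleftrightarrow> (\<forall>s\<in>J. \<forall>t\<in>K. s \<otimes> t = t \<otimes> s)"

lemma commuting_mono: "\<lbrakk>commuting J K; J' \<subseteq> J; K' \<subseteq> K\<rbrakk> \<Longrightarrow> commuting J' K'"
  unfolding commuting_def by blast

lemma generate_commute:
  assumes "K \<subseteq> carrier W" "x \<in> carrier W" "\<And>y. y \<in> K \<Longrightarrow> x \<otimes> y = y \<otimes> x" "y \<in> generate W K"
  shows "x \<otimes> y = y \<otimes> x"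
  using assms(4)
proof induction
  case (inv h)
  then have h: "h \<in> carrier W" "x \<otimes> h = h \<otimes> x" using assms by auto
  have "h \<otimes> (x \<otimes> inv h) = x \<otimes> h \<otimes> inv h" using h assms by (simp flip: m_assoc)
  also have "\<dots> = x" using h(1) assms(2) by (simp add: m_assoc)
  finally show ?case using h assms inv_solve_left[of "x \<otimes> inv h" h x] by simp
next
  case (eng h1 h2)
  then have "h1 \<in> carrier W" "h2 \<in> carrier W" using assms generate_in_carrier by auto
  then show ?case using eng assms by (metis m_assoc)
qed (use assms in auto)

lemma par_commute:
  assumes "J \<subseteq> S" "K \<subseteq> S" "commuting J K" "x \<in> par J" "y \<in> par K"
  shows "x \<otimes> y = y \<otimes> x"
proof (rule generate_commute[OF _ _ _ assms(5)])
  fix t assume t: "t \<in> K"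
  have "t \<otimes> x = x \<otimes> t"
    by (rule generate_commute[OF _ _ _ assms(4)]) (use t assms S_carrier in \<open>auto simp: commuting_def\<close>)
  then show "x \<otimes> t = t \<otimes> x" by simp
qed (use assms S_carrier par_carrier in auto)

text \<open>Disjointness makes the lengths of the two longest elements add. As they commute, either
  can be moved to the end, where its own generators shorten it, so \<open>longest_element_eq\<close>
  recognises the product.\<close>

lemma
  assumes "bounded_par J" "bounded_par K" "J \<inter> K = {}" "commuting J K"
  shows bounded_par_Un: "bounded_par (J \<union> K)"
    and lg_Un: "lg (J \<union> K) = lg J \<otimes> lg K"
    and len_lg_Un: "len (lg (J \<union> K)) = len (lg J) + len (lg K)"
proof -
  have J: "J \<subseteq> S" "lg J \<in> par J" "lg J \<in> carrier W" and K: "K \<subseteq> S" "lg K \<in> par K" "lg K \<in> carrier W"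
    using assms bounded_par_S lg_par by auto
  let ?x = "lg J \<otimes> lg K"
  have len: "len ?x = len (lg J) + len (lg K)"
    using len_mult_right[of K "lg J" "lg K"] descents_par[of J "lg J"] J K assms by blast
  have comm: "lg J \<otimes> lg K = lg K \<otimes> lg J" using par_commute J K assms by blast
  have "s \<in> right_descents W S ?x" if s: "s \<in> J \<union> K" for s
  proof -
    have sS: "s \<in> S" "s \<in> carrier W" using s J K by auto
    consider "len (lg J) = Suc (len (lg J \<otimes> s))" "?x \<otimes> s = lg K \<otimes> (lg J \<otimes> s)"
      | "len (lg K) = Suc (len (lg K \<otimes> s))" "?x \<otimes> s = lg J \<otimes> (lg K \<otimes> s)"
      using s lg_right_descents[OF assms(1)] lg_right_descents[OF assms(2)] right_descents_iff J K sS
      by (metis (no_types, lifting) Un_iff comm m_assoc subsetD)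
    then show ?thesis
      using len_mult[of "lg K" "lg J \<otimes> s"] len_mult[of "lg J" "lg K \<otimes> s"] J K sS len
      by cases (auto simp: right_descents_def)
  qed
  then have r: "J \<union> K \<subseteq> right_descents W S ?x" by blast
  have "?x \<in> par (J \<union> K)" using J K par_mono[of J "J \<union> K"] par_mono[of K "J \<union> K"] par_mult by blast
  then show "bounded_par (J \<union> K)" "lg (J \<union> K) = ?x"
    using bounded_parI[OF _ _ r] longest_element_eq[OF _ _ r] J K by auto
  then show "len (lg (J \<union> K)) = len (lg J) + len (lg K)" using len by simp
qed

text \<open>Two involutions commute iff the square of their product is trivial, that is, iff its
  order divides 2; order 0 stands for infinite order. From here on adjacency is used as
  non-commutation.\<close>

lemma coxeter_adj_iff:
  assumes "s \<in> S" "t \<in> S"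
  shows "coxeter_adj W s t \<longleftrightarrow> s \<otimes> t \<noteq> t \<otimes> s"
proof -
  have c: "s \<otimes> t \<in> carrier W" using assms by simp
  have "s \<otimes> t = t \<otimes> s \<longleftrightarrow> (s \<otimes> t) \<otimes> (s \<otimes> t) = \<one>"
    using assms inv_mult_group[of s t] c by (metis S_closed S_inv inv_equality r_inv)
  also have "\<dots> \<longleftrightarrow> ord (s \<otimes> t) dvd 2"
    using c pow_eq_id[of "s \<otimes> t" 2] by (simp add: numeral_2_eq_2)
  also have "\<dots> \<longleftrightarrow> ord (s \<otimes> t) = 1 \<or> ord (s \<otimes> t) = 2"
    using dvd_imp_le[of "ord (s \<otimes> t)" 2] by (cases "ord (s \<otimes> t) = 0") auto
  finally show ?thesis unfolding coxeter_adj_def coxeter_m_def by auto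
qed

text \<open>If \<open>s\<close> and a letter \<open>a\<close> at the left end of a reduced word of \<open>w\<close> did not commute, then
  \<open>s a s\<close> would be a reduced prefix of \<open>s w\<close>, which forces \<open>s\<close> into the support of \<open>w\<close>.\<close>

lemma commutes_with_support:
  assumes "s \<in> S" "w \<in> carrier W" "s \<notin> support W S w" "w \<otimes> s = s \<otimes> w" "t \<in> support W S w"
  shows "s \<otimes> t = t \<otimes> s"
proof -
  have "\<forall>t\<in>set u. s \<otimes> t = t \<otimes> s" if "reduced u" "s \<notin> set u" "pr u \<otimes> s = s \<otimes> pr u" for u
    using that
  proof (induction u)
    case (Cons a u)
    note a = reduced_ConsD[OF Cons.prems(1)]
    define w where "w = pr u"
    have u: "u \<in> lists S" "set u = support W S w" "w \<in> carrier W"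
      using a(2) support_reduced by (auto simp: w_def reduced_def)
    have J: "{s, a} \<subseteq> S" using a assms by auto
    have "support W S (a \<otimes> w) = insert a (set u)" using support_reduced[OF Cons.prems(1)] by (simp add: w_def)
    then have "s \<notin> left_descents W S (a \<otimes> w)"
      using left_descents_support[of "a \<otimes> w"] a u Cons.prems by auto
    then have l: "len (s \<otimes> (a \<otimes> w)) = Suc (len (a \<otimes> w))"
      using len_left_cases[of s "a \<otimes> w"] a u assms by (auto simp: left_descents_def)
    have law: "len (a \<otimes> w) = Suc (len w)" using Cons.prems a(2) by (simp add: reduced_def w_def)
    have comm: "s \<otimes> (a \<otimes> w) = a \<otimes> (w \<otimes> s)" using Cons.prems a u assms by (simp add: w_def m_assoc)
    have sw: "s \<notin> left_descents W S w" using left_descents_support[of w] u Cons.prems by auto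
    \<comment> \<open>Commutation makes this element equal to
      \<open>a \<otimes> (w \<otimes> s)\<close>, so \<open>a\<close> shortens it; \<open>s\<close>
      does so by cancellation.\<close>
    have d: "{s, a} \<subseteq> left_descents W S (s \<otimes> (a \<otimes> w))"
    proof -
      have "a \<otimes> (s \<otimes> (a \<otimes> w)) = w \<otimes> s" using comm a u assms by simp
      moreover have "s \<otimes> (s \<otimes> (a \<otimes> w)) = a \<otimes> w" using a u assms(1) by simp
      ultimately show ?thesis using l law a u assms len_mult[of w s] by (simp add: left_descents_def)
    qed
    have sa: "s \<otimes> a = a \<otimes> s"
    proof (rule ccontr)
      assume n: "s \<otimes> a \<noteq> a \<otimes> s"
      \<comment> \<open>As both letters are left descents, \<open>z\<close> is a reduced left
        factor. Its length is odd and not 1, so at least 3; removing it from an element of length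
        \<open>len w + 2\<close> leaves \<open>s \<otimes> w\<close>, which would be shorter than
        \<open>w\<close>.\<close>
      define z where "z = s \<otimes> (a \<otimes> s)"
      have z: "z \<in> par {s, a}" unfolding z_def by (intro par_mult par_gen) auto
      have zc: "z \<in> carrier W" "inv z = z" using a assms by (auto simp: z_def inv_mult_group m_assoc)
      have "len z \<noteq> 1"
      proof
        assume "len z = 1"
        moreover obtain v where v: "v \<in> lists {s, a}" "reduced v" "pr v = z"
          using par_ex_reduced J z by blast
        ultimately obtain r where "v = [r]" by (auto simp: reduced_def length_Suc_conv)
        then have "z = s \<or> z = a" using v J by auto
        then show False
        proof
          assume "z = s"
          then have "s \<otimes> z = \<one>" using assms by simp
          then have "a \<otimes> s = \<one>" using a assms by (simp add: z_def)
          then have "a = s" using a assms by (metis S_closed inv_equality S_inv)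
          then show False using n by simp
        next
          assume "z = a"
          then have "s \<otimes> z = s \<otimes> a" by simp
          then show False using n a assms by (simp add: z_def)
        qed
      qed
      moreover have "odd (len z)"
        using len_parity(1)[of s "a \<otimes> s"] len_parity(1)[of a s] a assms by (simp add: z_def)
      ultimately have "len z \<ge> 3" by (cases "len z = 2") (auto simp: not_less_eq_eq elim!: oddE)
      moreover have "len (z \<otimes> (s \<otimes> (a \<otimes> w))) + len z = len (s \<otimes> (a \<otimes> w))"
        using left_descents_factor[OF J _ d z] a u assms zc by simp
      moreover have "z \<otimes> (s \<otimes> (a \<otimes> w)) = s \<otimes> w" using a u assms by (simp add: z_def m_assoc)
      ultimately have "len (s \<otimes> w) < len w" using l law by simp
      then show False using sw assms by (simp add: left_descents_def)
    qed
    have "a \<otimes> (w \<otimes> s) = a \<otimes> (s \<otimes> w)" using comm sa a u assms by (simp flip: m_assoc)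
    then have "w \<otimes> s = s \<otimes> w" using a u assms by simp
    then show ?case using Cons.IH Cons.prems a sa by (simp add: w_def)
  qed simp
  then show ?thesis using obtain_reduced assms by metis
qed

section \<open>Products over a list of blocks\<close>

text \<open>In a decreasing linear extension \<open>C \<inter> \<Union>(set L)\<close> is
  \<open>J_R\<close> of \<open>C\<close>, so the factors are those of
  \<open>lambda_bar\<close>.\<close>

fun right_prod :: "('a set \<Rightarrow> 'a) \<Rightarrow> 'a set list \<Rightarrow> 'a" where
  "right_prod f [] = \<one>" |
  "right_prod f (C # L) = f C \<otimes> lg (C \<inter> \<Union>(set L)) \<otimes> right_prod f L"

text \<open>\<open>A\<close> accumulates the blocks already passed: started at the empty set on a
  full list, \<open>C \<inter> A\<close> is \<open>J_L\<close> of \<open>C\<close>. Other starting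
  values are required by induction and by the study of a tail below one block.\<close>

fun left_prod :: "('a set \<Rightarrow> 'a) \<Rightarrow> 'a set \<Rightarrow> 'a set list \<Rightarrow> 'a" where
  "left_prod f A [] = \<one>" |
  "left_prod f A (C # L) = lg (C \<inter> A) \<otimes> f C \<otimes> left_prod f (A \<union> C) L"

text \<open>A linear extension of a staircase diagram in decreasing order, below blocks with union \<open>A\<close>.
  The commutation condition is all that is needed from the saturation axiom.\<close>

fun block_list :: "('a set \<Rightarrow> 'a) \<Rightarrow> 'a set \<Rightarrow> 'a set list \<Rightarrow> bool" where
  "block_list f A [] \<longleftrightarrow> True" |
  "block_list f A (C # L) \<longleftrightarrow>
     C \<subseteq> S \<and> f C \<in> carrier W \<and>
     commuting ((A \<inter> \<Union>(set L)) - C) C \<and>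
     bounded_par (C \<inter> \<Union>(set L)) \<and> bounded_par (C \<inter> A) \<and>
     C \<inter> \<Union>(set L) \<subseteq> right_descents W S (f C) \<and>
     C \<inter> A \<subseteq> left_descents W S (f C) \<and>
     support W S (f C \<otimes> lg (C \<inter> \<Union>(set L))) = C \<and>
     support W S (lg (C \<inter> A) \<otimes> f C) = C \<and>
     block_list f (A \<union> C) L"

section \<open>Lengths and left descents of products of blocks\<close>

lemma block_list_subset_S: "block_list f A L \<Longrightarrow> \<Union>(set L) \<subseteq> S"
  by (induction L arbitrary: A) auto

lemma block_list_in_par:
  assumes "block_list f A (C # L)"
  shows "f C \<otimes> lg (C \<inter> \<Union>(set L)) \<in> par C" and "f C \<in> par C"
proof -
  let ?J = "C \<inter> \<Union>(set L)"
  have b: "C \<subseteq> S" "bounded_par ?J" "f C \<in> carrier W" using assms by auto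
  show 1: "f C \<otimes> lg ?J \<in> par C"
    using support_subset_iff[of C "f C \<otimes> lg ?J"] b assms by auto
  have "lg ?J \<in> par C" using lg_par[OF b(2)] par_mono[of ?J C] by auto
  with 1 have "f C \<otimes> lg ?J \<otimes> lg ?J \<in> par C" by (rule par_mult)
  then show "f C \<in> par C" using b by simp
qed

lemma right_prod_par: "block_list f A L \<Longrightarrow> right_prod f L \<in> par (\<Union>(set L))"
proof (induction L arbitrary: A)
  case Nil
  show ?case using generate.one by auto
next
  case (Cons C L)
  then have "right_prod f L \<in> par (\<Union>(set L))" by auto
  then have "right_prod f L \<in> par (\<Union>(set (C # L)))" by (rule par_mono[rotated]) auto
  moreover have "f C \<otimes> lg (C \<inter> \<Union>(set L)) \<in> par (\<Union>(set (C # L)))"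
    by (rule par_mono[OF _ block_list_in_par(1)[OF Cons.prems]]) auto
  ultimately show ?case using par_mult by simp
qed

lemma right_prod_closed: "block_list f A L \<Longrightarrow> right_prod f L \<in> carrier W"
  using par_carrier[OF block_list_subset_S right_prod_par] .

text \<open>The right descents of the leading factor lie in \<open>C\<close>, and splitting off the
  longest element has removed those in \<open>C \<inter> \<Union>(set L)\<close>. So none lies in
  the union of the tail.\<close>

lemma block_list_factor:
  assumes "block_list f A (C # L)" "u \<in> par (\<Union>(set L))"
  shows "len (f C \<otimes> lg (C \<inter> \<Union>(set L)) \<otimes> u) = len (f C \<otimes> lg (C \<inter> \<Union>(set L))) + len u"
proof (rule len_mult_right[OF _ _ _ assms(2)])
  let ?v = "f C \<otimes> lg (C \<inter> \<Union>(set L))"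
  show "\<Union>(set L) \<subseteq> S" using assms block_list_subset_S[of f A "C # L"] by auto
  show "?v \<in> carrier W" using assms by auto
  have "right_descents W S ?v \<inter> (C \<inter> \<Union>(set L)) = {}"
    using lg_right_factor(2) assms by auto
  moreover have "right_descents W S ?v \<subseteq> C"
    using descents_par block_list_in_par(1)[OF assms(1)] assms by auto
  ultimately show "right_descents W S ?v \<inter> \<Union>(set L) = {}" by blast
qed

lemma len_right_prod:
  assumes "block_list f A (C # L)"
  shows "len (right_prod f (C # L)) + len (lg (C \<inter> \<Union>(set L))) = len (f C) + len (right_prod f L)"
  using block_list_factor[OF assms right_prod_par] lg_right_factor(1)[of "C \<inter> \<Union>(set L)" "f C"] assms by auto

text \<open>A generator of \<open>A\<close> inside \<open>C\<close> is already a left descent of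
  \<open>f C\<close>. Outside \<open>C\<close> it commutes with \<open>C\<close>, passes the leading
  factor and meets the tail, where the induction hypothesis for \<open>A \<union> C\<close>
  applies.\<close>

lemma right_prod_left_descents:
  assumes "block_list f A L" "A \<subseteq> S"
  shows "A \<inter> \<Union>(set L) \<subseteq> left_descents W S (right_prod f L)"
  using assms
proof (induction L arbitrary: A)
  case (Cons C L)
  define U J p where "U = \<Union>(set L)" and "J = C \<inter> U" and "p = right_prod f L"
  have C: "C \<subseteq> S" "f C \<in> carrier W" "bounded_par J" "lg J \<in> carrier W"
    "C \<inter> A \<subseteq> left_descents W S (f C)" "commuting ((A \<inter> U) - C) C"
    using Cons.prems by (auto simp: U_def J_def)
  have p: "p \<in> carrier W" using Cons.prems right_prod_closed by (auto simp: p_def)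
  have IH: "(A \<union> C) \<inter> U \<subseteq> left_descents W S p" using Cons by (simp add: U_def p_def)
  have len: "len (f C \<otimes> lg J \<otimes> p) + len (lg J) = len (f C) + len p"
    using len_right_prod[OF Cons.prems(1)] by (simp add: J_def U_def p_def)
  have v: "f C \<otimes> lg J \<in> par C" using block_list_in_par[OF Cons.prems(1)] by (simp add: J_def U_def)
  have "s \<in> left_descents W S (f C \<otimes> lg J \<otimes> p)" if s: "s \<in> A" "s \<in> C \<union> U" for s
  proof (cases "s \<in> C")
    case True
    then have sd: "len (s \<otimes> f C) < len (f C)" "s \<in> S" using s C by (auto simp: left_descents_def)
    \<comment> \<open>The induction hypothesis also covers \<open>J\<close>, since \<open>C\<close>
      has joined \<open>A\<close>. Hence u_J splits off \<open>p\<close>, and regrouping it with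
      \<open>p\<close> makes \<open>f C\<close> a length additive left factor.\<close>
    have "len (lg J \<otimes> p) + len (lg J) = len p" using lg_left_factor(1)[of J p] IH C p by (auto simp: J_def)
    then have "len (f C \<otimes> lg J \<otimes> p) = len (f C) + len (lg J \<otimes> p)" using len by simp
    moreover have "s \<otimes> (f C \<otimes> lg J \<otimes> p) = (s \<otimes> f C) \<otimes> (lg J \<otimes> p)" using sd C p by (simp add: m_assoc)
    ultimately show ?thesis
      using sd len_mult[of "s \<otimes> f C" "lg J \<otimes> p"] C p by (auto simp: left_descents_def)
  next
    case False
    with s have sU: "s \<in> U" "s \<in> S" using Cons.prems by auto
    have "len (s \<otimes> p) < len p" using IH s sU by (auto simp: left_descents_def)
    have "commuting {s} C" using C(6) sU s False by (auto simp: commuting_def)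
    then have "s \<otimes> (f C \<otimes> lg J) = f C \<otimes> lg J \<otimes> s" using par_commute[of "{s}" C s] sU C v par_gen by auto
    then have "s \<otimes> (f C \<otimes> lg J \<otimes> p) = f C \<otimes> lg J \<otimes> (s \<otimes> p)" using C p sU by (metis m_assoc m_closed S_closed)
    moreover have "len (f C \<otimes> lg J \<otimes> p) = len (f C \<otimes> lg J) + len p"
      using block_list_factor[OF Cons.prems(1), of p] right_prod_par Cons.prems by (auto simp: p_def U_def J_def)
    ultimately show ?thesis using sU \<open>len (s \<otimes> p) < len p\<close> len_mult[of "f C \<otimes> lg J" "s \<otimes> p"] C p
      by (auto simp: left_descents_def)
  qed
  then show ?case by (auto simp: p_def J_def U_def)
qed auto

text \<open>Write u_J' x = (u_J' u_J) (u_J x). Lengths add here, so the support contains that of u_J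
  x, which is already all of \<open>C\<close>.\<close>

lemma support_lg_antimono:
  assumes "bounded_par J" "J' \<subseteq> J" "J \<subseteq> left_descents W S x" "x \<in> par C" "C \<subseteq> S"
    "support W S (lg J \<otimes> x) = C"
  shows "support W S (lg J' \<otimes> x) = C"
proof
  have J: "J \<subseteq> S" "bounded_par J'" using assms bounded_par_S bounded_par_subset by auto
  have x: "x \<in> carrier W" using assms par_carrier by auto
  have JC: "J' \<subseteq> C" using assms descents_par(1) by blast
  then have "lg J' \<in> par C" using lg_par J par_mono by blast
  then show "support W S (lg J' \<otimes> x) \<subseteq> C"
    using support_subset_iff[of C "lg J' \<otimes> x"] assms par_mult J x by auto
  define g where "g = lg J' \<otimes> lg J"
  have "lg J' \<otimes> x = g \<otimes> (lg J \<otimes> x)" using assms J x by (simp add: g_def m_assoc)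
  have gc: "g \<in> carrier W" using assms J by (simp add: g_def)
  have "J \<subseteq> left_descents W S (lg J)"
    using descents_inv[of "lg J"] lg_right_descents assms by auto
  then have "len g + len (lg J') = len (lg J)"
    using left_descents_factor[of J "lg J" "lg J'"] J lg_par[of J'] par_mono assms by (auto simp: g_def)
  moreover have "len (lg J' \<otimes> x) + len (lg J') = len x" "len (lg J \<otimes> x) + len (lg J) = len x"
    using lg_left_factor assms J x by auto
  ultimately have "len (g \<otimes> (lg J \<otimes> x)) = len g + len (lg J \<otimes> x)"
    using \<open>lg J' \<otimes> x = _\<close> by simp
  then have "support W S (lg J' \<otimes> x) = support W S g \<union> C"
    using support_mult[of g "lg J \<otimes> x"] gc x assms \<open>lg J' \<otimes> x = _\<close> by simp
  then show "C \<subseteq> support W S (lg J' \<otimes> x)" by blast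
qed

text \<open>Lets a tail be regarded as lying below \<open>C\<close> alone instead of below
  everything passed before it.\<close>

lemma block_list_mono:
  "\<lbrakk>block_list f A L; A' \<subseteq> A\<rbrakk> \<Longrightarrow> block_list f A' L"
proof (induction L arbitrary: A A')
  case (Cons C L)
  have "block_list f (A' \<union> C) L" using Cons by (auto intro: Cons.IH[of "A \<union> C"])
  moreover have "bounded_par (C \<inter> A')" using Cons.prems bounded_par_subset[of "C \<inter> A" "C \<inter> A'"] by auto
  moreover have "commuting ((A' \<inter> \<Union>(set L)) - C) C"
    using Cons.prems commuting_mono[of "(A \<inter> \<Union>(set L)) - C" C "(A' \<inter> \<Union>(set L)) - C" C] by auto
  moreover have "support W S (lg (C \<inter> A') \<otimes> f C) = C"
    using support_lg_antimono[of "C \<inter> A" "C \<inter> A'" "f C" C] Cons.prems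
      block_list_in_par(2)[OF Cons.prems(1)] by auto
  ultimately show ?case using Cons.prems by auto
qed simp

section \<open>Moving a longest element through a product of blocks\<close>

lemma bounded_par_empty [simp]: "bounded_par {}" and lg_empty [simp]: "lg {} = \<one>"
  using bounded_parI[of "{}" \<one>] longest_element_eq[of "{}" \<one>] generate.one[of W "{}"] by auto

lemma block_list_bounded:
  assumes "block_list f A L" "A \<subseteq> S"
  shows "bounded_par (A \<inter> \<Union>(set L))"
  using assms
proof (induction L arbitrary: A)
  case (Cons C L)
  let ?K = "(A \<inter> \<Union>(set L)) - C"
  have "bounded_par ((A \<union> C) \<inter> \<Union>(set L))" using Cons by auto
  then have "bounded_par ?K" by (rule bounded_par_subset) auto
  moreover have "commuting ?K (C \<inter> A)" using Cons.prems commuting_mono[of ?K C ?K "C \<inter> A"] by auto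
  ultimately have "bounded_par (?K \<union> (C \<inter> A))" using bounded_par_Un[of ?K "C \<inter> A"] Cons.prems by auto
  moreover have "?K \<union> (C \<inter> A) = A \<inter> \<Union>(set (C # L))" by auto
  ultimately show ?case by simp
qed auto

text \<open>\<open>K\<close> is the part of the longest element that can pass \<open>C\<close>, with
  which it commutes. Before \<open>C\<close> it is accompanied by \<open>C \<inter> A\<close>, after
  \<open>C\<close> by the intersection of \<open>C\<close> with the tail.\<close>

lemma lg_split:
  assumes "block_list f A (C # L)" "A \<subseteq> S"
  defines "K \<equiv> (A \<inter> \<Union>(set L)) - C"
  shows "bounded_par K"
    and "lg (A \<inter> \<Union>(set (C # L))) = lg (C \<inter> A) \<otimes> lg K"
    and "len (lg (A \<inter> \<Union>(set (C # L)))) = len (lg (C \<inter> A)) + len (lg K)"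
    and "lg ((A \<union> C) \<inter> \<Union>(set L)) = lg K \<otimes> lg (C \<inter> \<Union>(set L))"
    and "len (lg ((A \<union> C) \<inter> \<Union>(set L))) = len (lg K) + len (lg (C \<inter> \<Union>(set L)))"
proof -
  show K: "bounded_par K"
    using block_list_bounded[OF assms(1,2)] by (rule bounded_par_subset) (auto simp: K_def)
  have comm: "commuting K C" using assms by auto
  have comm': "commuting C K" using comm unfolding commuting_def by metis
  have b: "bounded_par (C \<inter> A)" "bounded_par (C \<inter> \<Union>(set L))" using assms by auto
  have 1: "commuting (C \<inter> A) K" "(C \<inter> A) \<inter> K = {}"
    using commuting_mono[OF comm', of "C \<inter> A" K] by (auto simp: K_def)
  have e: "A \<inter> \<Union>(set (C # L)) = (C \<inter> A) \<union> K" by (auto simp: K_def)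
  show "lg (A \<inter> \<Union>(set (C # L))) = lg (C \<inter> A) \<otimes> lg K"
    "len (lg (A \<inter> \<Union>(set (C # L)))) = len (lg (C \<inter> A)) + len (lg K)"
    unfolding e using lg_Un len_lg_Un b K 1 by auto
  have 2: "commuting K (C \<inter> \<Union>(set L))" "K \<inter> (C \<inter> \<Union>(set L)) = {}"
    using commuting_mono[OF comm, of K "C \<inter> \<Union>(set L)"] by (auto simp: K_def)
  have e: "(A \<union> C) \<inter> \<Union>(set L) = K \<union> (C \<inter> \<Union>(set L))" by (auto simp: K_def)
  show "lg ((A \<union> C) \<inter> \<Union>(set L)) = lg K \<otimes> lg (C \<inter> \<Union>(set L))"
    "len (lg ((A \<union> C) \<inter> \<Union>(set L))) = len (lg K) + len (lg (C \<inter> \<Union>(set L)))"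
    unfolding e using lg_Un len_lg_Un b K 2 by auto
qed

text \<open>At \<open>C\<close> the part for \<open>C \<inter> A\<close> stays in front of
  \<open>f C\<close>. The part for \<open>K\<close> moves past \<open>f C\<close> and joins the
  longest element behind it, giving the longest element with which the tail is entered.\<close>

lemma left_prod_eq:
  assumes "block_list f A L" "A \<subseteq> S"
  shows "left_prod f A L = lg (A \<inter> \<Union>(set L)) \<otimes> right_prod f L"
  using assms
proof (induction L arbitrary: A)
  case (Cons C L)
  define K where "K = (A \<inter> \<Union>(set L)) - C"
  note split = lg_split[OF Cons.prems, folded K_def]
  define J where "J = C \<inter> \<Union>(set L)"
  define p where "p = right_prod f L"
  have b: "bounded_par J" "bounded_par (C \<inter> A)" "C \<subseteq> S" "f C \<in> carrier W"
    using Cons.prems by (auto simp: J_def)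
  have p: "p \<in> carrier W" using Cons.prems right_prod_closed by (auto simp: p_def)
  have comm: "lg K \<otimes> f C = f C \<otimes> lg K"
    using par_commute[of K C "lg K" "f C"] bounded_par_S[OF split(1)] b lg_par[OF split(1)]
      block_list_in_par(2)[OF Cons.prems(1)] Cons.prems by (auto simp: K_def)
  have "left_prod f (A \<union> C) L = lg K \<otimes> lg J \<otimes> p"
    using Cons b split(4) by (simp add: p_def J_def)
  then have "left_prod f A (C # L) = lg (C \<inter> A) \<otimes> (f C \<otimes> lg K) \<otimes> (lg J \<otimes> p)"
    using b p split(1) by (simp add: m_assoc)
  also have "\<dots> = lg (C \<inter> A) \<otimes> lg K \<otimes> (f C \<otimes> lg J \<otimes> p)"
    unfolding comm[symmetric] using b p split(1) by (simp add: m_assoc)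
  also have "\<dots> = lg (A \<inter> \<Union>(set (C # L))) \<otimes> right_prod f (C # L)"
    unfolding split(2) by (simp add: J_def p_def)
  finally show ?case .
qed simp

lemma len_left_prod:
  assumes "block_list f A L" "A \<subseteq> S"
  shows "len (left_prod f A L) + len (lg (A \<inter> \<Union>(set L))) = len (right_prod f L)"
  unfolding left_prod_eq[OF assms]
  using lg_left_factor(1) block_list_bounded right_prod_closed right_prod_left_descents assms by blast

lemma left_prod_closed: "\<lbrakk>block_list f A L; A \<subseteq> S\<rbrakk> \<Longrightarrow> left_prod f A L \<in> carrier W"
  using left_prod_eq block_list_bounded right_prod_closed by simp

text \<open>The lengths of the factors of \<open>left_prod\<close> add up because those of \<open>right_prod\<close> do.\<close>

lemma support_left_prod:
  assumes "block_list f A L" "A \<subseteq> S"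
  shows "support W S (left_prod f A L) = \<Union>(set L)"
  using assms
proof (induction L arbitrary: A)
  case Nil
  then show ?case using support_subset_iff[of "{}" \<one>] generate.one[of W "{}"] by auto
next
  case (Cons C L)
  have C: "C \<subseteq> S" "f C \<in> carrier W" "bounded_par (C \<inter> A)" "block_list f (A \<union> C) L"
    "C \<inter> A \<subseteq> left_descents W S (f C)" "support W S (lg (C \<inter> A) \<otimes> f C) = C"
    using Cons.prems by auto
  have AC: "A \<union> C \<subseteq> S" using C Cons.prems by auto
  have "len (lg (C \<inter> A) \<otimes> f C \<otimes> left_prod f (A \<union> C) L) =
      len (lg (C \<inter> A) \<otimes> f C) + len (left_prod f (A \<union> C) L)"
    using len_left_prod[OF Cons.prems] len_left_prod[OF C(4) AC] lg_left_factor(1)[OF C(3,2,5)]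
      len_right_prod[OF Cons.prems(1)] lg_split(3,5)[OF Cons.prems] by simp
  then show ?case using support_mult[of "lg (C \<inter> A) \<otimes> f C"] C left_prod_closed[OF C(4) AC] Cons.IH[OF C(4) AC]
    by simp
qed

text \<open>Two factorizations serve the two cases: \<open>v \<otimes> p\<close> is length additive
  against the whole subgroup of \<open>U\<close>, and \<open>f C \<otimes> m\<close> against the
  whole subgroup of \<open>C\<close>.\<close>

lemma right_descents_right_prod_Cons:
  assumes "block_list f A (C # L)"
  shows "s \<in> right_descents W S (right_prod f (C # L)) \<longleftrightarrow>
    (if s \<in> \<Union>(set L) then s \<in> right_descents W S (right_prod f L)
     else s \<in> C \<and> commuting {s} (\<Union>(set L)) \<and> s \<in> right_descents W S (f C))"
proof -
  define U J p where "U = \<Union>(set L)" and "J = C \<inter> U" and "p = right_prod f L"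
  have C: "C \<subseteq> S" "f C \<in> carrier W" "bounded_par J" "lg J \<in> carrier W" "U \<subseteq> S" "J \<subseteq> S"
    using assms block_list_subset_S[OF assms] by (auto simp: U_def J_def)
  have bl: "block_list f C L" "block_list f (A \<union> C) L"
    using assms block_list_mono[of f "A \<union> C" L C] by auto
  have p: "p \<in> par U" "p \<in> carrier W" using bl right_prod_closed right_prod_par by (auto simp: p_def U_def)
  define v where "v = f C \<otimes> lg J"
  have v: "v \<in> carrier W" using C by (simp add: v_def)
  have P: "right_prod f (C # L) = v \<otimes> p" by (simp add: v_def J_def U_def p_def)
  have lenv: "len (v \<otimes> u) = len v + len u" if "u \<in> par U" for u
    using block_list_factor[OF assms] that by (simp add: v_def J_def U_def)
  show ?thesis
  proof (cases "s \<in> U")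
    case True
    then have "p \<otimes> s \<in> par U" using p par_mult par_gen by auto
    then have "len (v \<otimes> (p \<otimes> s)) < len (v \<otimes> p) \<longleftrightarrow> len (p \<otimes> s) < len p"
      using lenv p by simp
    moreover have "s \<in> S" using True C by auto
    ultimately show ?thesis using True p v unfolding P
      by (simp add: right_descents_def U_def[symmetric] p_def[symmetric] m_assoc)
  next
    case sU: False
    \<comment> \<open>Starting \<open>left_prod\<close> at \<open>C\<close> strips u_J from
      \<open>p\<close> but keeps the full support \<open>U\<close>; this later gives commutation
      with all of \<open>U\<close>.\<close>
    define m where "m = left_prod f C L"
    have J: "J = C \<inter> U" by (simp add: J_def)
    have m: "m = lg J \<otimes> p" "len m + len (lg J) = len p" "support W S m = U"
      using left_prod_eq[OF bl(1) C(1)] len_left_prod[OF bl(1) C(1)] support_left_prod[OF bl(1) C(1)]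
      by (simp_all add: m_def J_def U_def p_def)
    have mc: "m \<in> carrier W" using m C p by simp
    have mU: "m \<in> par U" using in_par_support[OF mc] m by simp
    have vm: "v \<otimes> p = f C \<otimes> m" using C p by (simp add: v_def m m_assoc)
    have lenm: "len (f C \<otimes> m) = len (f C) + len m"
      using len_right_prod[OF assms] m(2) vm by (simp add: J_def U_def p_def v_def)
    have "left_descents W S m \<inter> J = {}"
      using lg_left_factor(2)[of J p] C p right_prod_left_descents[OF bl(1) C(1)]
      by (simp add: m J_def U_def p_def)
    moreover have "left_descents W S m \<subseteq> U" using descents_par C mU by blast
    ultimately have md: "left_descents W S m \<inter> C = {}" by (auto simp: J)
    have fC: "f C \<in> par C" using block_list_in_par(2)[OF assms] .
    have lenCm: "len (u \<otimes> m) = len u + len m" if "u \<in> par C" for u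
      using len_mult_left[OF C(1) mc md that] .
    have sm: "s \<otimes> m = m \<otimes> s" if "s \<in> S" "commuting {s} U"
      using par_commute[of "{s}" U s m] that C mU par_gen by auto
    show ?thesis
    proof (cases "s \<in> S")
      case sS: True
      have "s \<in> C \<and> commuting {s} U \<and> s \<in> right_descents W S (f C)"
        if "s \<in> right_descents W S (f C \<otimes> m)"
      proof -
        have less: "len (f C \<otimes> m \<otimes> s) < len (f C \<otimes> m)" using that by (simp add: right_descents_def)
        have "s \<notin> right_descents W S m" using descents_par(2)[OF C(5) mU] sU by auto
        then have ms: "len (m \<otimes> s) = Suc (len m)"
          using len_right_cases[OF sS mc] sS by (auto simp: right_descents_def)
        \<comment> \<open>Since \<open>s\<close> lengthens \<open>m\<close>, the letter deleted by
          exchange belongs to \<open>f C\<close>.\<close>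
        from C(2) mc sS less obtain x' where x': "x' \<in> carrier W" "f C \<otimes> m \<otimes> s = x' \<otimes> m" "x' \<in> par C"
        proof (cases rule: exchange_product)
          case 1
          then show ?thesis using ms by simp
        next
          case (2 x')
          then show ?thesis using that C fC by blast
        qed
        \<comment> \<open>This is the element of the subgroup of \<open>C\<close> with
          \<open>m \<otimes> s = r \<otimes> m\<close>; additivity against that subgroup forces it
          to have length 1.\<close>
        define r where "r = inv (f C) \<otimes> x'"
        have r: "r \<in> par C" "r \<in> carrier W" using x' fC par_mult par_inv C by (auto simp: r_def)
        have "f C \<otimes> r = x'" using x' C by (simp add: r_def flip: m_assoc)
        then have "f C \<otimes> (m \<otimes> s) = f C \<otimes> (r \<otimes> m)"
          using x' C mc sS r by (metis m_assoc S_closed)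
        then have msr: "m \<otimes> s = r \<otimes> m" using C mc sS r by simp
        then have "len r = 1" using lenCm[OF r(1)] ms by simp
        then obtain a where a: "r = a" "a \<in> C"
        proof -
          obtain u where "u \<in> lists C" "reduced u" "pr u = r" using par_ex_reduced C r by blast
          moreover from this \<open>len r = 1\<close> have "length u = 1" by (simp add: reduced_def)
          then obtain a where "u = [a]" by (auto simp: length_Suc_conv)
          ultimately show ?thesis using that C by auto
        qed
        \<comment> \<open>As a conjugate of \<open>a\<close> by \<open>m\<close>, the generator
          \<open>s\<close> lies in the subgroup of \<open>insert a U\<close>; being outside
          \<open>U\<close>, it equals \<open>a\<close>.\<close>
        have "s = inv m \<otimes> (r \<otimes> m)" unfolding msr[symmetric] using mc sS by (simp flip: m_assoc)
        moreover have "inv m \<otimes> (r \<otimes> m) \<in> par (insert a U)"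
        proof -
          have "m \<in> par (insert a U)" using mU par_mono[of U "insert a U"] by auto
          moreover have "r \<in> par (insert a U)" using a par_gen[of r "insert a U"] by auto
          ultimately show ?thesis using par_mult par_inv[of "insert a U" m] C a by auto
        qed
        ultimately have "s \<in> insert a U" using S_in_par_iff[of "insert a U" s] C a sS by auto
        then have "s = a" using sU by simp
        then have sC: "s \<in> C" and comm: "m \<otimes> s = s \<otimes> m" using a msr by auto
        have "commuting {s} U"
          using commutes_with_support[OF sS mc _ comm] m(3) sU by (auto simp: commuting_def)
        moreover have "len (f C \<otimes> s) < len (f C)"
        proof -
          have "f C \<otimes> s \<in> par C" using fC sC par_mult par_gen by auto
          from lenCm[OF this] have "len (f C \<otimes> m \<otimes> s) = len (f C \<otimes> s) + len m"
            using C mc sS comm by (simp add: m_assoc)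
          then show ?thesis using less lenm by simp
        qed
        ultimately show ?thesis using sC sS by (simp add: right_descents_def)
      qed
      moreover have "s \<in> right_descents W S (f C \<otimes> m)"
        if "commuting {s} U" "s \<in> right_descents W S (f C)"
      proof -
        have "f C \<otimes> m \<otimes> s = (f C \<otimes> s) \<otimes> m" using sm[OF sS that(1)] C mc sS by (simp add: m_assoc)
        then show ?thesis
          using lenm len_mult[of "f C \<otimes> s" m] that C mc sS by (auto simp: right_descents_def)
      qed
      ultimately show ?thesis using sU unfolding P vm by (auto simp: U_def[symmetric])
    next
      case False
      then show ?thesis using sU by (auto simp: right_descents_def U_def)
    qed
  qed
qed

text \<open>Unrolls the recursion at the last block of the list that contains
  \<open>s\<close>.\<close>

lemma right_descents_right_prod:
  assumes "block_list f A L"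
  shows "s \<in> right_descents W S (right_prod f L) \<longleftrightarrow>
    (\<exists>P C Q. L = P @ C # Q \<and> s \<in> C \<and> s \<notin> \<Union>(set Q) \<and> commuting {s} (\<Union>(set Q)) \<and>
      s \<in> right_descents W S (f C))"
  using assms
proof (induction L arbitrary: A)
  case Nil
  then show ?case by (auto simp: right_descents_def)
next
  case (Cons C L)
  have IH: "s \<in> right_descents W S (right_prod f L) \<longleftrightarrow>
    (\<exists>P C Q. L = P @ C # Q \<and> s \<in> C \<and> s \<notin> \<Union>(set Q) \<and> commuting {s} (\<Union>(set Q)) \<and>
      s \<in> right_descents W S (f C))" using Cons.prems by (intro Cons.IH[of "A \<union> C"]) simp
  show ?case
  proof (cases "s \<in> \<Union>(set L)")
    case True
    show ?thesis unfolding right_descents_right_prod_Cons[OF Cons.prems] if_P[OF True] IH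
    proof
      assume "\<exists>P B Q. L = P @ B # Q \<and> s \<in> B \<and> s \<notin> \<Union>(set Q) \<and> commuting {s} (\<Union>(set Q)) \<and>
          s \<in> right_descents W S (f B)"
      then show "\<exists>P B Q. C # L = P @ B # Q \<and> s \<in> B \<and> s \<notin> \<Union>(set Q) \<and> commuting {s} (\<Union>(set Q)) \<and>
          s \<in> right_descents W S (f B)"
        by (metis append_Cons)
    next
      assume "\<exists>P B Q. C # L = P @ B # Q \<and> s \<in> B \<and> s \<notin> \<Union>(set Q) \<and> commuting {s} (\<Union>(set Q)) \<and>
          s \<in> right_descents W S (f B)"
      then obtain P B Q where *: "C # L = P @ B # Q" "s \<in> B" "s \<notin> \<Union>(set Q)"
          "commuting {s} (\<Union>(set Q))" "s \<in> right_descents W S (f B)" by blast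
      then obtain P' where "P = C # P'" using True by (cases P) auto
      with * have "L = P' @ B # Q" by simp
      with * show "\<exists>P B Q. L = P @ B # Q \<and> s \<in> B \<and> s \<notin> \<Union>(set Q) \<and> commuting {s} (\<Union>(set Q)) \<and>
          s \<in> right_descents W S (f B)" by blast
    qed
  next
    case False
    show ?thesis unfolding right_descents_right_prod_Cons[OF Cons.prems] if_not_P[OF False]
    proof
      assume "s \<in> C \<and> commuting {s} (\<Union>(set L)) \<and> s \<in> right_descents W S (f C)"
      then show "\<exists>P B Q. C # L = P @ B # Q \<and> s \<in> B \<and> s \<notin> \<Union>(set Q) \<and> commuting {s} (\<Union>(set Q)) \<and>
          s \<in> right_descents W S (f B)"
        using False by (intro exI[of _ "[]"] exI[of _ C] exI[of _ L]) simp
    next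
      assume "\<exists>P B Q. C # L = P @ B # Q \<and> s \<in> B \<and> s \<notin> \<Union>(set Q) \<and> commuting {s} (\<Union>(set Q)) \<and>
          s \<in> right_descents W S (f B)"
      then obtain P B Q where *: "C # L = P @ B # Q" "s \<in> B" "commuting {s} (\<Union>(set Q))"
          "s \<in> right_descents W S (f B)" by blast
      then have "P = []" using False by (cases P) auto
      with * show "s \<in> C \<and> commuting {s} (\<Union>(set L)) \<and> s \<in> right_descents W S (f C)" by simp
    qed
  qed
qed

end

section \<open>Linear extensions\<close>

lemma linear_extension_iff:
  "linear_extension D R Bs \<longleftrightarrow> distinct Bs \<and> set Bs = D \<and> sorted_wrt (\<lambda>x y. (y, x) \<notin> R) Bs"
  unfolding linear_extension_def sorted_wrt_iff_nth_less by (metis leD leI order.strict_trans)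

lemma linear_extension_rev:
  "linear_extension D R Bs \<Longrightarrow> linear_extension D (R\<inverse>) (rev Bs)"
  by (simp add: linear_extension_iff sorted_wrt_rev)

lemma finite_chain_minimum:
  assumes "trans R" "finite C" "C \<noteq> {}" "C \<in> Chains R"
  shows "\<exists>B. is_minimum R C B"
  using assms(2-4)
proof (induction rule: finite_ne_induct)
  case (singleton x)
  then show ?case by (auto simp: is_minimum_def Chains_def)
next
  case (insert x F)
  then obtain B where B: "is_minimum R F B" by (auto simp: Chains_def)
  then have "(x, B) \<in> R \<or> (B, x) \<in> R" "(x, x) \<in> R"
    using insert.prems by (auto simp: Chains_def is_minimum_def)
  then show ?case using B transD[OF assms(1)] unfolding is_minimum_def by blast
qed

lemma minimum_eq: "\<lbrakk>antisym R; is_minimum R C B\<rbrakk> \<Longrightarrow> minimum R C = B"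
  unfolding minimum_def is_minimum_def by (rule the_equality) (auto dest: antisymD)

text \<open>Put a minimal element first and continue with a linear extension of the rest.\<close>

lemma ex_linear_extension:
  assumes "trans R" "antisym R" "finite D"
  shows "\<exists>Bs. linear_extension D R Bs"
  using assms(3)
proof (induction D rule: finite_psubset_induct)
  case (psubset D)
  show ?case
  proof (cases "D = {}")
    case True
    then show ?thesis by (intro exI[of _ "[]"]) (simp add: linear_extension_def)
  next
    case False
    have "\<exists>m\<in>D. \<forall>x\<in>D. (x, m) \<in> R \<longrightarrow> x = m"
      using psubset.hyps False
    proof (induction rule: finite_ne_induct)
      case (insert x F)
      then obtain m where m: "m \<in> F" "\<forall>x\<in>F. (x, m) \<in> R \<longrightarrow> x = m" by blast
      show ?case
      proof (cases "(x, m) \<in> R")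
        case True
        then have "y = x" if "y \<in> insert x F" "(y, x) \<in> R" for y
          using that m transD[OF assms(1)] antisymD[OF assms(2)] by blast
        then show ?thesis by blast
      next
        case False
        then show ?thesis using m by blast
      qed
    qed simp
    then obtain m where m: "m \<in> D" "\<forall>x\<in>D. (x, m) \<in> R \<longrightarrow> x = m" by blast
    then obtain Bs where "linear_extension (D - {m}) R Bs" using psubset.IH[of "D - {m}"] by blast
    then have "linear_extension D R (m # Bs)" using m by (auto simp: linear_extension_iff)
    then show ?thesis by blast
  qed
qed

section \<open>Independence of the linear extension and positional forms of the recursions\<close>

context coxeter_group
begin

lemma pr_map_commute:
  assumes "x \<in> carrier W" "g ` set P \<subseteq> carrier W" "\<And>B. B \<in> set P \<Longrightarrow> x \<otimes> g B = g B \<otimes> x"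
  shows "x \<otimes> pr (map g P) = pr (map g P) \<otimes> x"
  using assms(2,3)
proof (induction P)
  case (Cons B P)
  then have "pr (map g P) \<in> carrier W" by (intro pr_closed) auto
  then show ?case using Cons assms(1) by (simp flip: m_assoc) (simp add: m_assoc)
qed (use assms in auto)

text \<open>A block in front of \<open>C\<close> in \<open>L'\<close> comes after \<open>C\<close>
  in \<open>L\<close>, so the two are incomparable and their factors commute. Hence \<open>C\<close>
  can be moved to the front of \<open>L'\<close>.\<close>

lemma pr_map_linear_extensions:
  assumes "distinct L" "distinct L'" "set L = set L'"
    and "sorted_wrt (\<lambda>x y. (x, y) \<notin> R) L" "sorted_wrt (\<lambda>x y. (x, y) \<notin> R) L'"
    and "g ` set L \<subseteq> carrier W"
    and "\<And>x y. \<lbrakk>x \<in> set L; y \<in> set L; (x, y) \<notin> R; (y, x) \<notin> R\<rbrakk> \<Longrightarrow> g x \<otimes> g y = g y \<otimes> g x"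
  shows "pr (map g L) = pr (map g L')"
  using assms
proof (induction L arbitrary: L')
  case (Cons C L)
  then have "C \<in> set L'" by auto
  then obtain P Q where L': "L' = P @ C # Q" using split_list by metis
  have PQ: "set (P @ Q) = set L" using Cons.prems(1-3) unfolding L' by auto
  have c: "g C \<in> carrier W" "g ` set P \<subseteq> carrier W" "g ` set Q \<subseteq> carrier W"
    "set (map g P) \<subseteq> carrier W" "set (map g Q) \<subseteq> carrier W"
    using Cons.prems(6) PQ by auto
  have "pr (map g L) = pr (map g (P @ Q))"
    by (rule Cons.IH) (use Cons.prems PQ in \<open>auto simp: L' sorted_wrt_append\<close>)
  moreover have "g C \<otimes> pr (map g P) = pr (map g P) \<otimes> g C"
  proof (rule pr_map_commute)
    fix B assume "B \<in> set P"
    then show "g C \<otimes> g B = g B \<otimes> g C"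
      using Cons.prems(4,5) PQ by (intro Cons.prems(7)) (auto simp: L' sorted_wrt_append)
  qed (use c in auto)
  ultimately show ?case using c unfolding L'
    by (simp add: pr_append flip: m_assoc)
qed auto

lemma right_prod_eq_pr:
  assumes "\<And>P C Q. L = P @ C # Q \<Longrightarrow> g C = f C \<otimes> lg (C \<inter> \<Union>(set Q))"
  shows "right_prod f L = pr (map g L)"
  using assms
proof (induction L)
  case (Cons C L)
  have "right_prod f L = pr (map g L)" by (rule Cons.IH) (use Cons.prems in \<open>metis append_Cons\<close>)
  then show ?case using Cons.prems[of "[]" C L] by simp
qed simp

lemma left_prod_eq_pr:
  assumes "\<And>P C Q. L = P @ C # Q \<Longrightarrow> h C = lg (C \<inter> (A \<union> \<Union>(set P))) \<otimes> f C"
  shows "left_prod f A L = pr (map h L)"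
  using assms
proof (induction L arbitrary: A)
  case (Cons C L)
  have "left_prod f (A \<union> C) L = pr (map h L)"
  proof (rule Cons.IH)
    fix P B Q assume "L = P @ B # Q"
    then show "h B = lg (B \<inter> (A \<union> C \<union> \<Union>(set P))) \<otimes> f B"
      using Cons.prems[of "C # P" B Q] by (simp add: Un_assoc)
  qed
  then show ?case using Cons.prems[of "[]" C L] by simp
qed simp

text \<open>At a block preceded by \<open>P\<close> the accumulated set is
  \<open>A \<union> \<Union>(set P)\<close>, so the recursion becomes a condition on every splitting
  of the list.\<close>

lemma block_listI:
  assumes "\<And>P C Q. L = P @ C # Q \<Longrightarrow>
     C \<subseteq> S \<and> f C \<in> carrier W \<and>
     commuting (((A \<union> \<Union>(set P)) \<inter> \<Union>(set Q)) - C) C \<and>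
     bounded_par (C \<inter> \<Union>(set Q)) \<and> bounded_par (C \<inter> (A \<union> \<Union>(set P))) \<and>
     C \<inter> \<Union>(set Q) \<subseteq> right_descents W S (f C) \<and>
     C \<inter> (A \<union> \<Union>(set P)) \<subseteq> left_descents W S (f C) \<and>
     support W S (f C \<otimes> lg (C \<inter> \<Union>(set Q))) = C \<and>
     support W S (lg (C \<inter> (A \<union> \<Union>(set P))) \<otimes> f C) = C"
  shows "block_list f A L"
  using assms
proof (induction L arbitrary: A)
  case (Cons C L)
  have "block_list f (A \<union> C) L"
  proof (rule Cons.IH, goal_cases)
    case (1 P B Q)
    then show ?case using Cons.prems[of "C # P" B Q] by (simp add: Un_assoc)
  qed
  then show ?case using Cons.prems[of "[]" C L] by simp
qed simp

end

section \<open>Staircase diagrams\<close>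

lemma is_minimum_converse [simp]: "is_minimum (R\<inverse>) = is_maximum R"
  and is_maximum_converse [simp]: "is_maximum (R\<inverse>) = is_minimum R"
  by (auto simp: is_minimum_def is_maximum_def fun_eq_iff)

lemma minimum_converse [simp]: "minimum (R\<inverse>) = maximum R"
  and maximum_converse [simp]: "maximum (R\<inverse>) = minimum R"
  by (auto simp: minimum_def maximum_def fun_eq_iff)

lemma J_R_converse [simp]: "J_R D (R\<inverse>) = J_L D R" and J_L_converse [simp]: "J_L D (R\<inverse>) = J_R D R"
  by (auto simp: J_R_def J_L_def fun_eq_iff)

lemma Chains_converse [simp]: "Chains (R\<inverse>) = Chains R"
  by (auto simp: Chains_def)

lemma saturated_in_converse [simp]: "saturated_in (R\<inverse>) C C' = saturated_in R C C'"
  unfolding saturated_in_def by auto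

lemma covers_converse [simp]: "covers (R\<inverse>) B B' = covers R B' B"
  unfolding covers_def by auto

lemma staircase_diagram_flip:
  assumes "staircase_diagram S adj D R"
  shows "staircase_diagram S adj D (R\<inverse>)"
proof -
  have "graph_connected adj (B \<union> B')" if "B \<in> D" "B' \<in> D" "covers R B' B" for B B'
    using assms that unfolding staircase_diagram_def by (metis Un_commute)
  then show ?thesis using assms unfolding staircase_diagram_def by (simp only: is_minimum_converse
        is_maximum_converse Chains_converse saturated_in_converse covers_converse partial_order_on_converse) blast
qed

text \<open>Finiteness of \<open>D\<close> provides linear extensions as lists and least elements of
  the chains \<open>blocks_at D s\<close>.\<close>

locale labelled_staircase = coxeter_group +
  fixes D :: "'a set set" and R :: "'a set rel" and lab :: "'a set \<Rightarrow> 'a"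
  assumes staircase: "staircase_diagram S (coxeter_adj W) D R"
    and finite_D: "finite D"
    and lab: "labelling W S D R lab"
begin

lemma order: "trans R" "antisym R" "refl_on D R"
  using staircase by (auto simp: staircase_diagram_def partial_order_on_def preorder_on_def)

lemma refl_R: "B \<in> D \<Longrightarrow> (B, B) \<in> R"
  using order(3) by (auto simp: refl_on_def)

lemma blocks: "B \<in> D \<Longrightarrow> B \<subseteq> S"
  using staircase by (auto simp: staircase_diagram_def)

lemma lab_closed: "B \<in> D \<Longrightarrow> lab B \<in> carrier W"
  using lab by (simp add: labelling_def)

lemma
  assumes "B \<in> D"
  shows bounded_J: "bounded_par (J_R D R B)" "bounded_par (J_L D R B)"
proof -
  have "J_R D R B \<subseteq> S" "J_L D R B \<subseteq> S"
    using blocks[OF assms] by (auto simp: J_R_def J_L_def)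
  then show "bounded_par (J_R D R B)" "bounded_par (J_L D R B)"
    using lab assms by (auto simp: labelling_def intro!: spherical_bounded_par)
qed

lemma chain_at: "\<lbrakk>B \<in> D; B' \<in> D; s \<in> B; s \<in> B'\<rbrakk> \<Longrightarrow> (B, B') \<in> R \<or> (B', B) \<in> R"
proof -
  assume *: "B \<in> D" "B' \<in> D" "s \<in> B" "s \<in> B'"
  then have "s \<in> S" using blocks by blast
  then have "blocks_at D s \<in> Chains R" using staircase by (simp add: staircase_diagram_def)
  then show ?thesis using * by (auto simp: Chains_def blocks_at_def)
qed

lemma noncommuting:
  assumes "s \<in> S" "t \<in> S" "s \<otimes> t \<noteq> t \<otimes> s"
  shows "blocks_at D s \<union> blocks_at D t \<in> Chains R"
    and "saturated_in R (blocks_at D s) (blocks_at D s \<union> blocks_at D t)"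
  using assms staircase coxeter_adj_iff[OF assms(1,2)] unfolding staircase_diagram_def by auto

lemma chain_adj:
  assumes "B \<in> D" "B' \<in> D" "s \<in> B" "t \<in> B'" "s \<otimes> t \<noteq> t \<otimes> s"
  shows "(B, B') \<in> R \<or> (B', B) \<in> R"
  using noncommuting(1)[of s t] assms blocks by (auto simp: Chains_def blocks_at_def)

lemma minimum_at:
  assumes "blocks_at D s \<noteq> {}"
  shows "minimum R (blocks_at D s) \<in> D" "s \<in> minimum R (blocks_at D s)"
    and "\<lbrakk>B \<in> D; s \<in> B\<rbrakk> \<Longrightarrow> (minimum R (blocks_at D s), B) \<in> R"
proof -
  have "blocks_at D s \<in> Chains R" using chain_at by (auto simp: Chains_def blocks_at_def)
  then obtain B where "is_minimum R (blocks_at D s) B"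
    using finite_chain_minimum[OF order(1) _ assms] finite_D by (auto simp: blocks_at_def)
  with minimum_eq[OF order(2) this] show
    "minimum R (blocks_at D s) \<in> D" "s \<in> minimum R (blocks_at D s)"
    "\<lbrakk>B \<in> D; s \<in> B\<rbrakk> \<Longrightarrow> (minimum R (blocks_at D s), B) \<in> R" for B
    by (auto simp: is_minimum_def blocks_at_def)
qed

text \<open>Replaces the definite description in \<open>J_R\<close> by a strictly smaller block
  through \<open>s\<close>, which can be located in a list.\<close>

lemma J_R_iff: "B \<in> D \<Longrightarrow> s \<in> J_R D R B \<longleftrightarrow> s \<in> B \<and> (\<exists>B'\<in>D. s \<in> B' \<and> B' \<noteq> B \<and> (B', B) \<in> R)"
  (is "_ \<Longrightarrow> ?l = ?r")
proof
  assume B: "B \<in> D" and ?l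
  then have "s \<in> B" "B \<noteq> minimum R (blocks_at D s)" "blocks_at D s \<noteq> {}"
    by (auto simp: J_R_def blocks_at_def)
  then show ?r using minimum_at[of s] B by metis
next
  assume B: "B \<in> D" and ?r
  then obtain B' where *: "B' \<in> D" "s \<in> B'" "B' \<noteq> B" "(B', B) \<in> R" "s \<in> B" by auto
  have "B \<noteq> minimum R (blocks_at D s)"
  proof
    assume "B = minimum R (blocks_at D s)"
    moreover have "blocks_at D s \<noteq> {}" using B * by (auto simp: blocks_at_def)
    ultimately have "(B, B') \<in> R" using minimum_at(3)[of s B'] * by auto
    then show False using * order(2) by (auto dest: antisymD)
  qed
  then show ?l using * by (auto simp: J_R_def)
qed

end

text \<open>Duality: every statement about minima and right descents yields one about maxima and
  left descents.\<close>

lemma (in labelled_staircase) flip: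
  "labelled_staircase W S D (R\<inverse>) (\<lambda>B. inv lab B)"
proof -
  have "support W S (inv (lab B) \<otimes> lg (J_L D R B)) = B"
    "support W S (lg (J_R D R B) \<otimes> inv (lab B)) = B" if B: "B \<in> D" for B
    using support_inv[of "lg (J_L D R B) \<otimes> lab B"] support_inv[of "lab B \<otimes> lg (J_R D R B)"]
      bounded_J[OF B] lab_closed[OF B] lab B by (auto simp: inv_mult_group labelling_def)
  then have "labelling W S D (R\<inverse>) (\<lambda>B. inv lab B)"
    using lab by (auto simp: labelling_def descents_inv)
  then show ?thesis
    using staircase_diagram_flip[OF staircase] finite_D coxeter_group_axioms
    by (simp add: labelled_staircase_def labelled_staircase_axioms_def)
qed

context labelled_staircase
begin

lemma J_L_iff: "B \<in> D \<Longrightarrow> s \<in> J_L D R B \<longleftrightarrow> s \<in> B \<and> (\<exists>B'\<in>D. s \<in> B' \<and> B' \<noteq> B \<and> (B, B') \<in> R)"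
  using labelled_staircase.J_R_iff[OF flip, of B s] by simp

section \<open>A staircase diagram listed in decreasing order\<close>

context
  fixes L :: "'a set list"
  assumes L: "linear_extension D R (rev L)"
begin

lemma L_split:
  assumes "L = P @ C # Q"
  shows "C \<in> D" "set P \<subseteq> D" "set Q \<subseteq> D" "D = set P \<union> {C} \<union> set Q" "C \<notin> set P" "C \<notin> set Q"
    and "B \<in> set P \<Longrightarrow> (B, C) \<notin> R" and "B \<in> set Q \<Longrightarrow> (C, B) \<notin> R"
  using L assms by (auto simp: linear_extension_iff sorted_wrt_rev sorted_wrt_append)

text \<open>Blocks sharing a generator are comparable, so position in the list decides which of them
  lie below \<open>C\<close>.\<close>

lemma J_R_split:
  assumes "L = P @ C # Q"
  shows "J_R D R C = C \<inter> \<Union>(set Q)"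
proof -
  note * = L_split[OF assms]
  show ?thesis
  proof (intro equalityI subsetI)
    fix s assume "s \<in> J_R D R C"
    then obtain B where B: "s \<in> C" "B \<in> D" "s \<in> B" "B \<noteq> C" "(B, C) \<in> R"
      using J_R_iff[OF *(1)] by blast
    then have "B \<in> set Q" using *(4) *(7)[of B] by auto
    then show "s \<in> C \<inter> \<Union>(set Q)" using B by auto
  next
    fix s assume "s \<in> C \<inter> \<Union>(set Q)"
    then obtain B where B: "s \<in> C" "B \<in> set Q" "s \<in> B" by auto
    then have "B \<in> D" "B \<noteq> C" "(B, C) \<in> R"
      using *(2,3,5,6) *(8)[of B] chain_at[OF *(1), of B s] by auto
    then show "s \<in> J_R D R C" using J_R_iff[OF *(1)] B by auto
  qed
qed

lemma J_L_split:
  assumes "L = P @ C # Q"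
  shows "J_L D R C = C \<inter> \<Union>(set P)"
proof -
  note * = L_split[OF assms]
  show ?thesis
  proof (intro equalityI subsetI)
    fix s assume "s \<in> J_L D R C"
    then obtain B where B: "s \<in> C" "B \<in> D" "s \<in> B" "B \<noteq> C" "(C, B) \<in> R"
      using J_L_iff[OF *(1)] by blast
    then have "B \<in> set P" using *(4) *(8)[of B] by auto
    then show "s \<in> C \<inter> \<Union>(set P)" using B by auto
  next
    fix s assume "s \<in> C \<inter> \<Union>(set P)"
    then obtain B where B: "s \<in> C" "B \<in> set P" "s \<in> B" by auto
    then have "B \<in> D" "B \<noteq> C" "(C, B) \<in> R"
      using *(2,3,5,6) *(7)[of B] chain_at[OF *(1), of B s] by auto
    then show "s \<in> J_L D R C" using J_L_iff[OF *(1)] B by auto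
  qed
qed

text \<open>If \<open>s\<close> failed to commute with some \<open>t\<close> in \<open>C\<close>,
  then \<open>C\<close> would be comparable with an earlier and a later block through
  \<open>s\<close>, hence lie between them, and saturation would put \<open>s\<close> into
  \<open>C\<close>.\<close>

lemma commuting_split:
  assumes "L = P @ C # Q"
  shows "commuting ((\<Union>(set P) \<inter> \<Union>(set Q)) - C) C"
  unfolding commuting_def
proof (intro ballI)
  fix s t assume s: "s \<in> (\<Union>(set P) \<inter> \<Union>(set Q)) - C" and t: "t \<in> C"
  note * = L_split[OF assms]
  from s obtain B B' where B: "B \<in> set P" "s \<in> B" "B' \<in> set Q" "s \<in> B'" "s \<notin> C" by blast
  then have D: "B \<in> D" "B' \<in> D" "(B, C) \<notin> R" "(C, B') \<notin> R" using * by auto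
  show "s \<otimes> t = t \<otimes> s"
  proof (rule ccontr)
    assume n: "s \<otimes> t \<noteq> t \<otimes> s"
    have "s \<in> S" "t \<in> S" using B D t *(1) blocks by auto
    then have sat: "saturated_in R (blocks_at D s) (blocks_at D s \<union> blocks_at D t)"
      using noncommuting(2) n by simp
    have "(C, B) \<in> R" "(B', C) \<in> R" using chain_adj[of _ C s t] D B t n *(1) by auto
    moreover have "B \<in> blocks_at D s" "B' \<in> blocks_at D s" "C \<in> blocks_at D s \<union> blocks_at D t"
      using B D t *(1) by (simp_all add: blocks_at_def)
    ultimately have "C \<in> blocks_at D s" using sat unfolding saturated_in_def by blast
    then show False using B by (simp add: blocks_at_def)
  qed
qed

lemma block_list_L: "block_list lab {} L"
proof (rule block_listI)
  fix P C Q assume s: "L = P @ C # Q"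
  have C: "C \<in> D" "C \<subseteq> S" using L_split[OF s] blocks by auto
  have l: "lab C \<in> carrier W"
    "C \<inter> \<Union>(set Q) \<subseteq> right_descents W S (lab C)" "C \<inter> \<Union>(set P) \<subseteq> left_descents W S (lab C)"
    "support W S (lab C \<otimes> lg (C \<inter> \<Union>(set Q))) = C"
    "support W S (lg (C \<inter> \<Union>(set P)) \<otimes> lab C) = C"
    using lab C(1) by (simp_all add: labelling_def flip: J_R_split[OF s] J_L_split[OF s])
  have b: "bounded_par (C \<inter> \<Union>(set Q))" "bounded_par (C \<inter> \<Union>(set P))"
    using bounded_J[OF C(1)] by (simp_all flip: J_R_split[OF s] J_L_split[OF s])
  show "C \<subseteq> S \<and> lab C \<in> carrier W \<and>
     commuting ((({} \<union> \<Union>(set P)) \<inter> \<Union>(set Q)) - C) C \<and>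
     bounded_par (C \<inter> \<Union>(set Q)) \<and> bounded_par (C \<inter> ({} \<union> \<Union>(set P))) \<and>
     C \<inter> \<Union>(set Q) \<subseteq> right_descents W S (lab C) \<and>
     C \<inter> ({} \<union> \<Union>(set P)) \<subseteq> left_descents W S (lab C) \<and>
     support W S (lab C \<otimes> lg (C \<inter> \<Union>(set Q))) = C \<and>
     support W S (lg (C \<inter> ({} \<union> \<Union>(set P))) \<otimes> lab C) = C"
    using l b C(2) commuting_split[OF s] by simp
qed

lemma word_prod_lambda_bar: "pr (map (lambda_bar W S D R lab) L) = right_prod lab L"
  by (rule right_prod_eq_pr[symmetric]) (simp add: lambda_bar_def J_R_split)

lemma lambda_bar_par: "B \<in> D \<Longrightarrow> lambda_bar W S D R lab B \<in> par B"
  using support_subset_iff[of B "lambda_bar W S D R lab B"] lab blocks[of B] bounded_J(1)[of B] lab_closed[of B]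
  by (simp add: labelling_def lambda_bar_def)

lemma lambda_bar_closed: "B \<in> D \<Longrightarrow> lambda_bar W S D R lab B \<in> carrier W"
  using par_carrier[OF blocks lambda_bar_par] .

text \<open>Incomparable blocks commute elementwise by \<open>chain_adj\<close>, so all linear
  extensions give the same product and the description in \<open>Lambda\<close> denotes it.\<close>

lemma Lambda_eq: "Lambda W S D R lab = pr (map (lambda_bar W S D R lab) L)"
  unfolding Lambda_def
proof (rule the_equality)
  show "\<exists>Bs. linear_extension D R Bs \<and>
      pr (map (lambda_bar W S D R lab) L) = pr (map (lambda_bar W S D R lab) (rev Bs))"
    using L by (intro exI[of _ "rev L"]) simp
next
  fix w assume "\<exists>Bs. linear_extension D R Bs \<and> w = pr (map (lambda_bar W S D R lab) (rev Bs))"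
  then obtain Bs where Bs: "linear_extension D R Bs" "w = pr (map (lambda_bar W S D R lab) (rev Bs))"
    by blast
  have "pr (map (lambda_bar W S D R lab) (rev Bs)) = pr (map (lambda_bar W S D R lab) L)"
  proof (rule pr_map_linear_extensions)
    show "lambda_bar W S D R lab ` set (rev Bs) \<subseteq> carrier W"
      using Bs lambda_bar_closed by (auto simp: linear_extension_iff)
    fix B B' assume "B \<in> set (rev Bs)" "B' \<in> set (rev Bs)" and n: "(B, B') \<notin> R" "(B', B) \<notin> R"
    then have D: "B \<in> D" "B' \<in> D" using Bs by (auto simp: linear_extension_iff)
    then have "commuting B B'" using chain_adj n by (auto simp: commuting_def)
    then show "lambda_bar W S D R lab B \<otimes> lambda_bar W S D R lab B' =
        lambda_bar W S D R lab B' \<otimes> lambda_bar W S D R lab B"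
      using par_commute[of B B'] D blocks lambda_bar_par by simp
  qed (use L Bs in \<open>auto simp: linear_extension_iff sorted_wrt_rev\<close>)
  then show "w = pr (map (lambda_bar W S D R lab) L)" using Bs by simp
qed

lemma Lambda_right_prod: "Lambda W S D R lab = right_prod lab L"
  using Lambda_eq word_prod_lambda_bar by simp

text \<open>The last block of \<open>L\<close> through \<open>s\<close> is the minimum at
  \<open>s\<close>. Commutation with all later blocks says that the minimum at a neighbour of
  \<open>s\<close> is never listed after it.\<close>

lemma right_descents_Lambda:
  "s \<in> right_descents W S (Lambda W S D R lab) \<longleftrightarrow>
    s \<in> S \<and> blocks_at D s \<noteq> {} \<and>
    (\<forall>t\<in>S. coxeter_adj W t s \<and> blocks_at D t \<noteq> {} \<longrightarrow>
      (minimum R (blocks_at D s), minimum R (blocks_at D t)) \<in> R) \<and>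
    s \<in> right_descents W S (lab (minimum R (blocks_at D s)))"
  (is "?l \<longleftrightarrow> ?r")
proof
  assume ?l
  then obtain P C Q where s: "L = P @ C # Q" "s \<in> C" "s \<notin> \<Union>(set Q)"
      "commuting {s} (\<Union>(set Q))" "s \<in> right_descents W S (lab C)"
    unfolding Lambda_right_prod right_descents_right_prod[OF block_list_L] by blast
  note * = L_split[OF s(1)]
  have sS: "s \<in> S" using s by (simp add: right_descents_def)
  have ne: "blocks_at D s \<noteq> {}" using s *(1) by (auto simp: blocks_at_def)
  have C: "minimum R (blocks_at D s) = C"
  proof -
    \<comment> \<open>The minimum is not listed after \<open>C\<close> because \<open>s\<close>
      occurs in no later block, and not before \<open>C\<close> because it lies below
      \<open>C\<close>.\<close>
    have "minimum R (blocks_at D s) \<in> set P \<union> {C}" using minimum_at(1,2)[OF ne] *(4) s by blast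
    then show ?thesis using minimum_at(3)[OF ne *(1) s(2)] *(7) by blast
  qed
  have "(C, minimum R (blocks_at D t)) \<in> R"
    if t: "t \<in> S" "coxeter_adj W t s" "blocks_at D t \<noteq> {}" for t
  proof -
    let ?B = "minimum R (blocks_at D t)"
    note m = minimum_at[OF t(3)]
    have n: "s \<otimes> t \<noteq> t \<otimes> s" using t coxeter_adj_iff sS by metis
    then have "?B \<notin> set Q" using s(4) m(2) by (auto simp: commuting_def)
    then have "?B = C \<or> ?B \<in> set P" using m(1) *(4) by blast
    then show ?thesis
    proof
      assume "?B \<in> set P"
      then show ?thesis using chain_adj[OF *(1) m(1) s(2) m(2) n] *(7) by blast
    qed (use refl_R *(1) in simp)
  qed
  then show ?r using sS ne C s by auto
next
  assume r: ?r
  define C where "C = minimum R (blocks_at D s)"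
  have C: "C \<in> D" "s \<in> C" "\<And>B. \<lbrakk>B \<in> D; s \<in> B\<rbrakk> \<Longrightarrow> (C, B) \<in> R"
    using minimum_at r by (auto simp: C_def)
  have "C \<in> set L" using C L by (auto simp: linear_extension_iff)
  then obtain P Q where s: "L = P @ C # Q" using split_list by metis
  note * = L_split[OF s]
  have "s \<notin> \<Union>(set Q)" using C *(3,8) by blast
  moreover have "commuting {s} (\<Union>(set Q))"
  proof -
    \<comment> \<open>A neighbour \<open>t\<close> in a later block \<open>B\<close> would put
      \<open>C\<close> below the minimum at \<open>t\<close>, hence below \<open>B\<close>, against
      the order of the list.\<close>
    have "s \<otimes> t = t \<otimes> s" if t: "t \<in> B" "B \<in> set Q" for t B
    proof (rule ccontr)
      assume n: "s \<otimes> t \<noteq> t \<otimes> s"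
      have B: "B \<in> D" "t \<in> S" "blocks_at D t \<noteq> {}" using t *(3) blocks by (auto simp: blocks_at_def)
      have "coxeter_adj W t s" using coxeter_adj_iff[of t s] n B r by auto
      then have "(C, minimum R (blocks_at D t)) \<in> R" using r B by (simp add: C_def)
      moreover have "(minimum R (blocks_at D t), B) \<in> R" using minimum_at(3) B t by simp
      ultimately have "(C, B) \<in> R" using order(1) by (auto dest: transD)
      then show False using *(8) t by simp
    qed
    then show ?thesis by (auto simp: commuting_def)
  qed
  moreover have "s \<in> right_descents W S (lab C)" using r by (simp add: C_def)
  ultimately show ?l
    unfolding Lambda_right_prod right_descents_right_prod[OF block_list_L] using s C(2) by blast
qed

end

lemma ex_decreasing_extension: "\<exists>L. linear_extension D R (rev L)"
  using ex_linear_extension[OF order(1,2) finite_D] by (metis rev_rev_ident)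

lemma Lambda_closed: "Lambda W S D R lab \<in> carrier W"
  using ex_decreasing_extension Lambda_right_prod block_list_L right_prod_closed by metis

text \<open>The factors of the flipped product are the inverses of \<open>h B\<close>, so its
  inverse is \<open>left_prod\<close> started at the empty set. There \<open>left_prod_eq\<close>
  has a trivial longest element and gives \<open>right_prod\<close>.\<close>

lemma Lambda_flip: "Lambda W S D (R\<inverse>) (\<lambda>B. inv lab B) = inv Lambda W S D R lab"
proof -
  obtain L where L: "linear_extension D R (rev L)" using ex_decreasing_extension by blast
  define h where "h = (\<lambda>B. lg (J_L D R B) \<otimes> lab B)"
  have setL: "set L = D" using L by (simp add: linear_extension_iff)
  have h: "h B \<in> carrier W" "lambda_bar W S D (R\<inverse>) (\<lambda>B. inv lab B) B = inv (h B)" if "B \<in> D" for B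
    using bounded_J(2)[OF that] lab_closed[OF that] by (simp_all add: h_def lambda_bar_def inv_mult_group)
  have rev: "pr (map (\<lambda>B. inv (h B)) (rev P)) = inv (pr (map h P))" if "set P \<subseteq> D" for P
    using that
  proof (induction P)
    case (Cons B P)
    then have "set (map h P) \<subseteq> carrier W" "set (map (\<lambda>B. inv (h B)) (rev P)) \<subseteq> carrier W"
      "h B \<in> carrier W" using h by auto
    then show ?case using Cons by (simp add: pr_append inv_mult_group)
  qed simp
  have "Lambda W S D (R\<inverse>) (\<lambda>B. inv lab B) = pr (map (lambda_bar W S D (R\<inverse>) (\<lambda>B. inv lab B)) (rev L))"
    using labelled_staircase.Lambda_eq[OF flip, of "rev L"] linear_extension_rev[OF L] by simp
  also have "\<dots> = pr (map (\<lambda>B. inv (h B)) (rev L))"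
    using h setL by (intro arg_cong[of _ _ pr] map_cong) auto
  also have "\<dots> = inv (pr (map h L))" using rev setL by simp
  also have "pr (map h L) = left_prod lab {} L"
    by (rule left_prod_eq_pr[symmetric]) (simp add: h_def J_L_split[OF L])
  also have "\<dots> = right_prod lab L"
    using left_prod_eq[OF block_list_L[OF L]] right_prod_closed[OF block_list_L[OF L]] by simp
  finally show ?thesis using Lambda_right_prod[OF L] by simp
qed

end

theorem theorem3p7:
  fixes W :: "('a, 'm) monoid_scheme"
    and S :: "'a set"
    and D :: "'a set set"
    and R :: "'a set rel"
    and lab :: "'a set \<Rightarrow> 'a"
  assumes "coxeter_system W S"
    and "staircase_diagram S (coxeter_adj W) D R"
    and "finite D"
    and "labelling W S D R lab"
  shows "
    Lambda W S D (R\<inverse>) (\<lambda>B. inv\<^bsub>W\<^esub> lab B) = inv\<^bsub>W\<^esub> Lambda W S D R lab \<and>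
    right_descents W S (Lambda W S D R lab) =
      {s \<in> S. blocks_at D s \<noteq> {} \<and>
        (\<forall>t\<in>S. coxeter_adj W t s \<and> blocks_at D t \<noteq> {} \<longrightarrow>
          (minimum R (blocks_at D s), minimum R (blocks_at D t)) \<in> R) \<and>
        s \<in> right_descents W S (lab (minimum R (blocks_at D s)))} \<and>
    left_descents W S (Lambda W S D R lab) =
      {s \<in> S. blocks_at D s \<noteq> {} \<and>
        (\<forall>t\<in>S. coxeter_adj W t s \<and> blocks_at D t \<noteq> {} \<longrightarrow>
          (maximum R (blocks_at D t), maximum R (blocks_at D s)) \<in> R) \<and>
        s \<in> left_descents W S (lab (maximum R (blocks_at D s)))}"
proof -
  interpret labelled_staircase W S D R lab
    using assms coxeter_system_imp_coxeter_group
    by (simp add: labelled_staircase_def labelled_staircase_axioms_def)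
  \<comment> \<open>Left descents of \<open>Lambda\<close> are right descents of its inverse, which
    is the \<open>Lambda\<close> of the flip; the minima of the flip are the maxima of
    \<open>R\<close>.\<close>
  interpret flip: labelled_staircase W S D "R\<inverse>" "\<lambda>B. inv\<^bsub>W\<^esub> lab B" by (rule flip)
  have right: "right_descents W S (Lambda W S D R lab) =
      {s \<in> S. blocks_at D s \<noteq> {} \<and>
        (\<forall>t\<in>S. coxeter_adj W t s \<and> blocks_at D t \<noteq> {} \<longrightarrow>
          (minimum R (blocks_at D s), minimum R (blocks_at D t)) \<in> R) \<and>
        s \<in> right_descents W S (lab (minimum R (blocks_at D s)))}"
    using ex_decreasing_extension right_descents_Lambda by blast
  \<comment> \<open>A nonempty chain makes the maximum an actual block, so its label lies in the
    group and inversion exchanges the descent sets.\<close>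
  have lab': "right_descents W S (inv\<^bsub>W\<^esub> lab (maximum R (blocks_at D s))) =
      left_descents W S (lab (maximum R (blocks_at D s)))" if "blocks_at D s \<noteq> {}" for s
    using flip.minimum_at(1)[OF that] lab by (intro descents_inv) (auto simp: labelling_def)
  obtain L where L: "linear_extension D (R\<inverse>) (rev L)" using flip.ex_decreasing_extension by blast
  have "s \<in> right_descents W S (Lambda W S D (R\<inverse>) (\<lambda>B. inv\<^bsub>W\<^esub> lab B)) \<longleftrightarrow>
      s \<in> S \<and> blocks_at D s \<noteq> {} \<and>
        (\<forall>t\<in>S. coxeter_adj W t s \<and> blocks_at D t \<noteq> {} \<longrightarrow>
          (maximum R (blocks_at D t), maximum R (blocks_at D s)) \<in> R) \<and>
        s \<in> left_descents W S (lab (maximum R (blocks_at D s)))" for s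
    using lab'[of s] by (simp add: flip.right_descents_Lambda[OF L] cong: conj_cong)
  moreover have "left_descents W S (Lambda W S D R lab) =
      right_descents W S (Lambda W S D (R\<inverse>) (\<lambda>B. inv\<^bsub>W\<^esub> lab B))"
    using Lambda_flip Lambda_closed descents_inv by simp
  ultimately have "left_descents W S (Lambda W S D R lab) = {s \<in> S. blocks_at D s \<noteq> {} \<and>
        (\<forall>t\<in>S. coxeter_adj W t s \<and> blocks_at D t \<noteq> {} \<longrightarrow>
          (maximum R (blocks_at D t), maximum R (blocks_at D s)) \<in> R) \<and>
        s \<in> left_descents W S (lab (maximum R (blocks_at D s)))}"
    by blast
  with right Lambda_flip show ?thesis by simp
qed

end
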